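(* Let $P$ be a convex $n$-gon with $n\ge 3$ and let $e$ be a boundary edge of $P$. Consider the maximal simplices of the noncrossing partition link $\mathrm{Link}(\mathrm{NC}_n)$ of $P$ whose labels are properly ordered noncrossing trees (on the vertices of $P$) that do not contain the edge $e$. These simplices, together with all of their faces, form a contractible subcomplex of $\mathrm{Link}(\mathrm{NC}_n)$.
   Context: A \emph{noncrossing partition} of a convex $n$-gon $P$ is a partition of its vertex set such that the convex hulls of the blocks are pairwise disjoint. Ordered by refinement ($\pi\le\pi'$ if every block of $\pi$ is contained in a block of $\pi'$), the noncrossing partitions form a bounded graded lattice $\mathrm{NC}_n$. The \emph{noncrossing partition link} $\mathrm{Link}(\mathrm{NC}_n)$ is the order complex of $\mathrm{NC}_n$ with its minimum and maximum elements removed; its maximal simplices correspond to the maximal chains of $\mathrm{NC}_n$. Each noncrossing partition $\pi$ is identified with a permutation of the vertices of $P$: each vertex $v$ is sent to the next vertex, in clockwise order, of the convex hull of the block of $\pi$ containing $v$. Permutations are multiplied as functions (right factor applied first). For a covering relation $\pi<\pi'$, the permutation $\pi'\pi^{-1}$ is a transposition, which is regarded as the edge (segment) joining the two vertices of $P$ that it exchanges. For a maximal chain $\pi_0<\pi_1<\dots<\pi_{n-1}$ of $\mathrm{NC}_n$, put $t_i=\pi_i\pi_{i-1}^{-1}$, so that the product $t_{n-1}\cdots t_2t_1$ is the $n$-cycle $c$ corresponding to the clockwise boundary cycle of $P$. The edges $t_1,\dots,t_{n-1}$ form a \emph{noncrossing tree}: a tree whose vertices are the vertices of $P$, whose edges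 are the straight segments joining their endpoints, and in which distinct edges are disjoint or meet only at a single common vertex. With its edges ordered so that the product of the corresponding transpositions in that order is $c$, this tree is a \emph{properly ordered noncrossing tree}. It is the label of the maximal simplex of $\mathrm{Link}(\mathrm{NC}_n)$ given by the chain, and this labeling is a bijection between maximal simplices and properly ordered noncrossing trees. A \emph{boundary edge} of $P$ is an edge joining two vertices of $P$ that is contained in the boundary of $P$. *)

theory Defs
  imports "HOL-Analysis.Analysis"
begin

text \<open>Simplices are nonempty finite sets of vertices (the empty simplex is not included).\<close>

definition simplicial_complex_on :: "'a set set \<Rightarrow> bool" where
  "simplicial_complex_on K \<longleftrightarrow>
     (\<forall>F\<in>K. finite F \<and> F \<noteq> {}) \<and> (\<forall>F\<in>K. \<forall>G. G \<subseteq> F \<and> G \<noteq> {} \<longrightarrow> G \<in> K)"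

definition subcomplex :: "'a set set \<Rightarrow> 'a set set \<Rightarrow> bool" where
  "subcomplex K L \<longleftrightarrow> simplicial_complex_on K \<and> K \<subseteq> L"

definition maximal_simplex :: "'a set set \<Rightarrow> 'a set \<Rightarrow> bool" where
  "maximal_simplex K F \<longleftrightarrow> F \<in> K \<and> (\<forall>G\<in>K. \<not> F \<subset> G)"

definition closure_complex :: "'a set set \<Rightarrow> 'a set set" where
  "closure_complex S = {G. G \<noteq> {} \<and> (\<exists>F\<in>S. G \<subseteq> F)}"

definition order_complex :: "('a \<Rightarrow> 'a \<Rightarrow> bool) \<Rightarrow> 'a set \<Rightarrow> 'a set set" where
  "order_complex le A =
     {C. C \<subseteq> A \<and> finite C \<and> C \<noteq> {} \<and> (\<forall>x\<in>C. \<forall>y\<in>C. le x y \<or> le y x)}"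

text \<open>Points are given by barycentric coordinates, with the topology induced by the product
  topology on functions.  For a complex with finitely many simplices, the only case used here,
  this is the usual topology of the geometric realization.\<close>

definition geometric_realization :: "'a set set \<Rightarrow> ('a \<Rightarrow> real) set" where
  "geometric_realization K =
     {x. (\<forall>v. 0 \<le> x v) \<and> {v. x v \<noteq> 0} \<in> K \<and> (\<Sum>v\<in>{v. x v \<noteq> 0}. x v) = 1}"

text \<open>The library counts the empty space as contractible, so nonemptiness is required explicitly.\<close>

definition contractible_complex :: "'a set set \<Rightarrow> bool" where
  "contractible_complex K \<longleftrightarrow>
     geometric_realization K \<noteq> {} \<and> contractible (geometric_realization K)"

definition vertices :: "complex set \<Rightarrow> complex set" where
  "vertices P = {v. v extreme_point_of P}"

definition convex_polygon :: "nat \<Rightarrow> complex set \<Rightarrow> bool" where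
  "convex_polygon n P \<longleftrightarrow> polytope P \<and> aff_dim P = 2 \<and> card (vertices P) = n"

text \<open>An edge is represented by the set of its two endpoints; the segment itself is the
  convex hull of that set.\<close>

definition boundary_edge :: "complex set \<Rightarrow> complex set \<Rightarrow> bool" where
  "boundary_edge P e \<longleftrightarrow>
     e \<subseteq> vertices P \<and> card e = 2 \<and> convex hull e \<subseteq> frontier P"

definition noncrossing_partitions :: "complex set \<Rightarrow> complex set set set" where
  "noncrossing_partitions V =
     {\<pi>. partition_on V \<pi> \<and> pairwise (\<lambda>A B. disjnt (convex hull A) (convex hull B)) \<pi>}"

definition nc_bot :: "complex set \<Rightarrow> complex set set" where
  "nc_bot V = (\<lambda>v. {v}) ` V"

definition nc_top :: "complex set \<Rightarrow> complex set set" where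
  "nc_top V = {V}"

lemma nc_bot_least:
  shows "nc_bot V \<in> noncrossing_partitions V"
    and "\<pi> \<in> noncrossing_partitions V \<Longrightarrow> refines V (nc_bot V) \<pi>"
proof -
  have part: "partition_on V (nc_bot V)"
    by (auto simp: nc_bot_def partition_on_def disjoint_def)
  then show "nc_bot V \<in> noncrossing_partitions V"
    by (auto simp: noncrossing_partitions_def pairwise_def nc_bot_def)
  show "refines V (nc_bot V) \<pi>" if "\<pi> \<in> noncrossing_partitions V"
    using that part by (auto simp: noncrossing_partitions_def refines_def nc_bot_def partition_on_def)
qed

lemma nc_top_greatest:
  assumes "V \<noteq> {}"
  shows "nc_top V \<in> noncrossing_partitions V"
    and "\<pi> \<in> noncrossing_partitions V \<Longrightarrow> refines V \<pi> (nc_top V)"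
  using assms
  by (auto simp: noncrossing_partitions_def refines_def nc_top_def partition_on_def)

definition nc_link :: "complex set \<Rightarrow> complex set set set set" where
  "nc_link V = order_complex (refines V) (noncrossing_partitions V - {nc_bot V, nc_top V})"

text \<open>For a set \<open>B\<close> of points in convex position, the clockwise successor of \<open>v\<close> is the point \<open>w\<close>
  such that all other points of \<open>B\<close> lie strictly to the right of the directed line from \<open>v\<close> to
  \<open>w\<close>; here \<open>Im (cnj z * z')\<close> is the determinant of the vectors \<open>z\<close> and \<open>z'\<close>.\<close>

definition clockwise_next :: "complex set \<Rightarrow> complex \<Rightarrow> complex" where
  "clockwise_next B v =
     (if B = {v} then v
      else THE w. w \<in> B \<and> w \<noteq> v \<and> (\<forall>u\<in>B - {v, w}. Im (cnj (w - v) * (u - v)) < 0))"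

text \<open>The permutation of the vertices is extended by the identity to the whole plane.\<close>

definition nc_perm :: "complex set set \<Rightarrow> complex \<Rightarrow> complex" where
  "nc_perm \<pi> v = (if v \<in> \<Union>\<pi> then clockwise_next (THE B. B \<in> \<pi> \<and> v \<in> B) v else v)"

text \<open>The edge of a transposition consists of the two points that it moves.\<close>

definition cover_edge :: "complex set set \<Rightarrow> complex set set \<Rightarrow> complex set" where
  "cover_edge \<pi> \<pi>' = {v. (nc_perm \<pi>' \<circ> inv (nc_perm \<pi>)) v \<noteq> v}"

text \<open>The chain of a simplex of the link, including the minimum and the maximum, listed in
  increasing order.\<close>

definition full_chain :: "complex set \<Rightarrow> complex set set set \<Rightarrow> complex set set list" where
  "full_chain V F =
     (THE ps. sorted_wrt (\<lambda>\<pi> \<pi>'. refines V \<pi> \<pi>' \<and> \<pi> \<noteq> \<pi>') ps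
            \<and> set ps = insert (nc_bot V) (insert (nc_top V) F))"

definition simplex_label :: "complex set \<Rightarrow> complex set set set \<Rightarrow> complex set list" where
  "simplex_label V F =
     (let ps = full_chain V F in map2 cover_edge (butlast ps) (tl ps))"

definition is_tree :: "'a set \<Rightarrow> 'a set set \<Rightarrow> bool" where
  "is_tree V E \<longleftrightarrow>
     V \<noteq> {} \<and> (\<forall>d\<in>E. d \<subseteq> V \<and> card d = 2) \<and>
     (\<forall>u\<in>V. \<forall>v\<in>V. (u, v) \<in> {(x, y). {x, y} \<in> E}\<^sup>*) \<and>
     \<not> (\<exists>vs. 3 \<le> length vs \<and> distinct vs \<and>
            (\<forall>i<length vs. {vs ! i, vs ! (Suc i mod length vs)} \<in> E))"

definition noncrossing_tree :: "complex set \<Rightarrow> complex set set \<Rightarrow> bool" where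
  "noncrossing_tree V E \<longleftrightarrow>
     is_tree V E \<and>
     (\<forall>d\<in>E. \<forall>d'\<in>E. d \<noteq> d' \<longrightarrow>
        convex hull d \<inter> convex hull d' = {} \<or>
        (\<exists>v\<in>d \<inter> d'. convex hull d \<inter> convex hull d' = {v}))"

definition edge_transposition :: "'a set \<Rightarrow> 'a \<Rightarrow> 'a" where
  "edge_transposition d v = (if v \<in> d then the_elem (d - {v}) else v)"

lemma edge_transposition_eq_transpose:
  assumes "a \<noteq> b"
  shows "edge_transposition {a, b} = Transposition.transpose a b"
proof
  fix v
  have "{a, b} - {a} = {b}" "{a, b} - {b} = {a}"
    using assms by auto
  then show "edge_transposition {a, b} v = Transposition.transpose a b v"
    by (auto simp: edge_transposition_def Transposition.transpose_def)
qed

text \<open>The first edge of the list is the rightmost factor, that is, the one applied first.\<close>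

definition edge_product :: "'a set list \<Rightarrow> 'a \<Rightarrow> 'a" where
  "edge_product ts = fold (\<lambda>d f. edge_transposition d \<circ> f) ts id"

definition properly_ordered_noncrossing_tree :: "complex set \<Rightarrow> complex set list \<Rightarrow> bool" where
  "properly_ordered_noncrossing_tree V ts \<longleftrightarrow>
     distinct ts \<and> noncrossing_tree V (set ts) \<and> edge_product ts = nc_perm (nc_top V)"

end

theory Submission
  imports Defs
begin

text \<open>Let \<open>e = {a, b}\<close>, where \<open>b\<close> follows \<open>a\<close> clockwise, and list the vertices clockwise from \<open>b\<close> to \<open>a\<close>.
  A maximal chain of noncrossing partitions merges two blocks in each step, and a step has the edge
  \<open>e\<close> exactly if it merges the singleton \<open>{a}\<close> with the block of \<open>b\<close>.  Let \<open>middle\<close> be the set of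
  noncrossing partitions in which the block of \<open>a\<close> has other vertices but does not contain \<open>b\<close>.
  The step in which \<open>a\<close> stops being a singleton leads into \<open>middle\<close> or has the edge \<open>e\<close>, so the
  label of a chain avoids \<open>e\<close> if and only if the chain meets \<open>middle\<close>
  (\<open>label_avoids_edge_iff\<close>).  Hence the subcomplex is the union of the stars of the vertices in
  \<open>middle\<close> (\<open>complex_avoiding_edge_eq\<close>).

  The set \<open>middle\<close> is convex in the partition order, and chains of this subcomplex consist of
  elements of an upper part, which have an element of \<open>middle\<close> below or equal to them, and of a
  lower part.  The complex is the flag complex of a relation that orders an element \<open>\<sigma>\<close> of the lower
  part before an element \<open>\<pi>\<close> of the upper part only if some element of \<open>middle\<close> lies between them.
  The upper part contracts by \<open>\<pi> \<mapsto> \<pi> \<and> \<beta>\<close>, where \<open>\<beta>\<close> has the two blocks \<open>{b}\<close> and the rest.  The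
  elements of the lower part are attached one after the other in increasing order, and the link of
  \<open>\<sigma>\<close> is the join of what is already there below \<open>\<sigma>\<close> with the part of the upper part above \<open>\<sigma>\<close>.
  The latter contracts in the same way, where \<open>\<beta>\<close> now cuts the polygon behind the last vertex of the
  block of \<open>b\<close> in \<open>\<sigma>\<close>; that the meets stay in \<open>middle\<close> is where noncrossing is used
  (\<open>meets_with_element_above\<close>).  So every link is contractible, and so is the whole complex
  (\<open>contractible_compatible_chains\<close>).

  To turn this into a statement about realizations, contractibility is strengthened to being a
  retract of a space of sequences.  This property holds for simplices and is inherited by a union of
  two sets if both and their intersection have it (\<open>retract_of_UNIV_Un\<close>), and cones and attached
  vertices can be obtained from simplices by such unions.

  The labels of all maximal simplices are properly ordered noncrossing trees
  (\<open>properly_ordered_label\<close>): the edge of a step joins two blocks of the current partition, while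
  all earlier edges lie inside its blocks, so the edges are distinct, acyclic and noncrossing, they
  connect all vertices in the end, and the product of the transpositions telescopes.\<close>

section \<open>Gluing retracts of a space of sequences\<close>

text \<open>Tietze's theorem, one coordinate at a time.  A space of sequences is used because it is metrizable
  and has room for complexes with any finite number of vertices, which no single Euclidean space
  does.\<close>

lemma tietze_sequence_space:
  fixes f :: "(nat \<Rightarrow> real) \<Rightarrow> nat \<Rightarrow> real"
  assumes "closed T" and "continuous_on T f"
  obtains g where "continuous_on UNIV g" and "\<And>x. x \<in> T \<Longrightarrow> g x = f x"
proof -
  have "\<exists>h. continuous_on UNIV h \<and> (\<forall>x\<in>T. h x = f x i)" for i
  proof -
    have "continuous_on T (\<lambda>x. f x i)"
      using assms(2) by (rule continuous_on_product_then_coordinatewise)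
    moreover have "closedin (top_of_set UNIV) T"
      using assms(1) by simp
    ultimately show ?thesis
      by (metis Tietze_unbounded)
  qed
  then obtain h where h: "\<And>i. continuous_on UNIV (h i)" "\<And>i x. x \<in> T \<Longrightarrow> h i x = f x i"
    by metis
  show thesis
  proof
    show "continuous_on UNIV (\<lambda>x i. h i x)"
      using h(1) by (intro continuous_on_coordinatewise_then_product) auto
    show "(\<lambda>i. h i x) = f x" if "x \<in> T" for x
      using h(2) that by auto
  qed
qed

text \<open>Cut the space along the points \<open>D\<close> at equal distance from \<open>S\<close> and \<open>T\<close>.  On \<open>D\<close> use the retraction
  \<open>r\<close> onto \<open>S \<inter> T\<close>; on the side of \<open>S\<close> the map that is \<open>r\<close> on \<open>D\<close> and the identity on \<open>S\<close> extends
  to the whole space by Tietze, and a retraction onto \<open>S\<close> brings the extension back into \<open>S\<close>.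
  The other side is the same, and the two maps agree on \<open>D\<close>.  Being a retract of the whole space
  is thus preserved by gluing; contractibility alone would require a homotopy extension argument.\<close>

lemma retract_of_UNIV_Un:
  fixes S T :: "(nat \<Rightarrow> real) set"
  assumes S: "S retract_of UNIV" and T: "T retract_of UNIV" and ST: "S \<inter> T retract_of UNIV"
  shows "S \<union> T retract_of UNIV"
proof -
  obtain rS where rS: "continuous_on UNIV rS" "\<And>x. rS x \<in> S" "\<And>x. x \<in> S \<Longrightarrow> rS x = x"
    using S unfolding retract_of_def retraction_def by blast
  obtain rT where rT: "continuous_on UNIV rT" "\<And>x. rT x \<in> T" "\<And>x. x \<in> T \<Longrightarrow> rT x = x"
    using T unfolding retract_of_def retraction_def by blast
  obtain r where r: "continuous_on UNIV r" "\<And>x. r x \<in> S \<inter> T" "\<And>x. x \<in> S \<inter> T \<Longrightarrow> r x = x"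
    using ST unfolding retract_of_def retraction_def by blast
  have cl: "closed S" "closed T"
    using S T retract_of_closed closed_UNIV by blast+
  have ne: "S \<noteq> {}" "T \<noteq> {}"
    using r(2) by auto
  have zero: "infdist x S = 0 \<longleftrightarrow> x \<in> S" "infdist x T = 0 \<longleftrightarrow> x \<in> T" for x
    using cl ne in_closed_iff_infdist_zero by blast+
  define D where "D = {x. infdist x S = infdist x T}"
  have cont_d: "continuous_on UNIV (\<lambda>x. infdist x S)" "continuous_on UNIV (\<lambda>x. infdist x T)"
    by (intro continuous_intros)+
  have cl_D: "closed D"
    unfolding D_def using cont_d by (intro closed_Collect_eq)
  (* one side of the cut, for A = S with q the retraction onto S, and for A = T *)
  have extend: "\<exists>G. continuous_on UNIV G \<and> (\<forall>x. G x \<in> A) \<and> (\<forall>x\<in>A. G x = x) \<and> (\<forall>x\<in>D. G x = r x)"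
    if A: "closed A" "S \<inter> T \<subseteq> A" "A \<inter> D = S \<inter> T"
      and q: "continuous_on UNIV q" "\<And>x. q x \<in> A" "\<And>x. x \<in> A \<Longrightarrow> q x = x" for A q
  proof -
    let ?f = "\<lambda>x. if x \<in> A then x else r x"
    have "continuous_on D r"
      using r(1) by (rule continuous_on_subset) simp
    moreover have agree: "\<forall>x. x \<in> A \<and> x \<notin> A \<or> x \<in> D \<and> x \<in> A \<longrightarrow> x = r x"
      using A(3) r(3) by (metis IntI)
    ultimately have cont_f: "continuous_on (A \<union> D) ?f"
      by (rule continuous_on_cases[OF A(1) cl_D continuous_on_id])
    obtain g where g: "continuous_on UNIV g" "\<And>x. x \<in> A \<union> D \<Longrightarrow> g x = ?f x"
      by (rule tietze_sequence_space[OF closed_Un[OF A(1) cl_D] cont_f]) blast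
    have "continuous_on UNIV (q \<circ> g)"
      by (intro continuous_on_compose g continuous_on_subset[OF q(1)]) auto
    moreover have "(q \<circ> g) x = r x" if "x \<in> D" for x
    proof -
      have "g x = r x"
        using g(2)[of x] that agree by (metis UnI2)
      then show ?thesis
        using q(3) r(2) A(2) by auto
    qed
    ultimately show ?thesis
      using q g(2) by (intro exI[of _ "q \<circ> g"]) auto
  qed
  have D_S: "S \<inter> D = S \<inter> T" and D_T: "T \<inter> D = S \<inter> T"
    unfolding D_def using zero by auto
  obtain F where F: "continuous_on UNIV F" "\<And>x. F x \<in> S" "\<And>x. x \<in> S \<Longrightarrow> F x = x" "\<And>x. x \<in> D \<Longrightarrow> F x = r x"
    using extend[OF cl(1) _ D_S rS] by auto
  obtain G where G: "continuous_on UNIV G" "\<And>x. G x \<in> T" "\<And>x. x \<in> T \<Longrightarrow> G x = x" "\<And>x. x \<in> D \<Longrightarrow> G x = r x"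
    using extend[OF cl(2) _ D_T rT] by auto
  define H where "H x = (if infdist x S \<le> infdist x T then F x else G x)" for x
  have "continuous_on ({x. infdist x S \<le> infdist x T} \<union> {x. infdist x T \<le> infdist x S}) H"
    unfolding H_def
  proof (rule continuous_on_cases)
    show "closed {x. infdist x S \<le> infdist x T}" "closed {x. infdist x T \<le> infdist x S}"
      by (rule closed_Collect_le[OF cont_d], rule closed_Collect_le[OF cont_d(2,1)])
    show "continuous_on {x. infdist x S \<le> infdist x T} F" "continuous_on {x. infdist x T \<le> infdist x S} G"
      using F(1) G(1) continuous_on_subset by blast+
    show "\<forall>x. x \<in> {x. infdist x S \<le> infdist x T} \<and> \<not> infdist x S \<le> infdist x T \<or>
        x \<in> {x. infdist x T \<le> infdist x S} \<and> infdist x S \<le> infdist x T \<longrightarrow> F x = G x"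
      using F(4) G(4) unfolding D_def by auto
  qed
  moreover have "{x. infdist x S \<le> infdist x T} \<union> {x. infdist x T \<le> infdist x S} = UNIV"
    by auto
  ultimately have "continuous_on UNIV H"
    by simp
  moreover have "H x = x" if "x \<in> S \<union> T" for x
  proof (cases "x \<in> S")
    case True
    then show ?thesis
      by (simp add: H_def F infdist_nonneg)
  next
    case False
    then have "x \<in> T" "0 < infdist x S"
      using that zero infdist_nonneg[of x S] by (auto simp: less_le)
    then show ?thesis
      by (simp add: H_def G)
  qed
  moreover have "H x \<in> S \<union> T" for x
    using F(2) G(2) by (simp add: H_def)
  ultimately show ?thesis
    unfolding retract_of_def retraction_def by blast
qed

text \<open>The negative coordinates are cut off, a total mass above 1 is scaled down to 1, and a
  total mass below 1 is completed at the vertex \<open>w\<close>.\<close>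

lemma simplex_retract_of_UNIV:
  fixes W :: "nat set"
  assumes W: "finite W" "W \<noteq> {}"
  shows "geometric_realization {C. C \<subseteq> W \<and> C \<noteq> {}} retract_of UNIV"
proof -
  obtain w where w: "w \<in> W"
    using W by blast
  define s where "s x = (\<Sum>i\<in>W. max 0 (x i))" for x :: "nat \<Rightarrow> real"
  define r where "r x i =
      (if i \<in> W then max 0 (x i) / max 1 (s x) else 0) + (if i = w then 1 - s x / max 1 (s x) else 0)"
    for x i
  have real_eq: "geometric_realization {C. C \<subseteq> W \<and> C \<noteq> {}}
      = {x. (\<forall>i. 0 \<le> x i) \<and> (\<forall>i. i \<notin> W \<longrightarrow> x i = 0) \<and> sum x W = 1}" (is "?L = ?R")
  proof -
    have supp: "{v. x v \<noteq> 0} \<in> {C. C \<subseteq> W \<and> C \<noteq> {}} \<and> sum x {v. x v \<noteq> 0} = 1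
        \<longleftrightarrow> (\<forall>i. i \<notin> W \<longrightarrow> x i = 0) \<and> sum x W = 1" for x :: "nat \<Rightarrow> real"
    proof (cases "\<forall>i. i \<notin> W \<longrightarrow> x i = 0")
      case True
      then have "sum x {v. x v \<noteq> 0} = sum x W"
        using W by (intro sum.mono_neutral_left) auto
      moreover have "{v. x v \<noteq> 0} \<noteq> {}" if "sum x W = 1"
        using that by (metis (mono_tags, lifting) empty_Collect_eq sum.neutral zero_neq_one)
      moreover have "{v. x v \<noteq> 0} \<subseteq> W"
        using True by auto
      ultimately show ?thesis
        using True by (metis (lifting) mem_Collect_eq)
    qed blast
    show ?thesis
      unfolding geometric_realization_def supp ..
  qed
  have s_nonneg: "0 \<le> s x" for x
    unfolding s_def by (intro sum_nonneg) auto
  have cont_s: "continuous_on UNIV s"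
    unfolding s_def by (intro continuous_intros continuous_on_product_coordinates)
  have pos: "max 1 (s x) \<noteq> 0" for x
    by (simp add: max_def)
  have "continuous_on UNIV (\<lambda>x. r x i)" for i
    using cont_s pos unfolding r_def
    by (cases "i \<in> W"; cases "i = w") (auto intro!: continuous_intros)
  then have "continuous_on UNIV r"
    by (rule continuous_on_coordinatewise_then_product)
  moreover have "r x \<in> ?R" for x
  proof -
    have "sum (r x) W = (\<Sum>i\<in>W. max 0 (x i) / max 1 (s x)) + (1 - s x / max 1 (s x))"
      unfolding r_def using W w by (simp add: sum.distrib)
    also have "\<dots> = 1"
      by (simp add: s_def sum_divide_distrib)
    finally show ?thesis
      using w s_nonneg[of x] by (auto simp: r_def divide_le_eq_1 intro!: add_nonneg_nonneg)
  qed
  moreover have "r x = x" if x: "x \<in> ?R" for x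
  proof -
    have "s x = 1"
      using x by (simp add: s_def max_def)
    then show ?thesis
      using x by (auto simp: r_def max_def fun_eq_iff)
  qed
  ultimately show ?thesis
    unfolding real_eq retract_of_def retraction_def by blast
qed

section \<open>Flag complexes glued from cliques\<close>

text \<open>The complexes \<open>order_complex r S\<close> are used here for an arbitrary relation \<open>r\<close>, where they are the
  flag complexes of the comparability graph.  The predicate singles out the vertex sets whose complex
  arises from full simplices by gluing two complexes along a third one of the same kind.  The
  absence of edges between \<open>A - B\<close> and \<open>B - A\<close> makes the complex of the union the union of the
  complexes.\<close>

inductive glued_from_cliques :: "('a \<Rightarrow> 'a \<Rightarrow> bool) \<Rightarrow> 'a set \<Rightarrow> bool" for r where
  clique: "\<lbrakk>finite S; S \<noteq> {}; \<forall>x\<in>S. \<forall>y\<in>S. r x y \<or> r y x\<rbrakk> \<Longrightarrow> glued_from_cliques r S"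
| glue: "\<lbrakk>glued_from_cliques r A; glued_from_cliques r B; glued_from_cliques r (A \<inter> B);
    \<forall>x\<in>A - B. \<forall>y\<in>B - A. \<not> r x y \<and> \<not> r y x\<rbrakk> \<Longrightarrow> glued_from_cliques r (A \<union> B)"

lemma geometric_realization_Un:
  "geometric_realization (K \<union> L) = geometric_realization K \<union> geometric_realization L"
  unfolding geometric_realization_def by blast

lemma geometric_realization_Int:
  "geometric_realization (K \<inter> L) = geometric_realization K \<inter> geometric_realization L"
  unfolding geometric_realization_def by blast

lemma order_complex_Int: "order_complex r (A \<inter> B) = order_complex r A \<inter> order_complex r B"
  unfolding order_complex_def by blast

lemma order_complex_Un:
  assumes "\<forall>x\<in>A - B. \<forall>y\<in>B - A. \<not> r x y \<and> \<not> r y x"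
  shows "order_complex r (A \<union> B) = order_complex r A \<union> order_complex r B"
  using assms unfolding order_complex_def by blast

lemma glued_from_cliques_finite: "glued_from_cliques r S \<Longrightarrow> finite S"
  by (induction rule: glued_from_cliques.induct) auto

text \<open>The vertices are numbered by \<open>f\<close> to move the realization into a space of sequences, where gluing of
  retracts is available.\<close>

lemma glued_from_cliques_retract:
  fixes f :: "'a \<Rightarrow> nat"
  assumes "glued_from_cliques r S" and "inj_on f S"
  shows "geometric_realization ((`) f ` order_complex r S) retract_of UNIV"
  using assms
proof (induction rule: glued_from_cliques.induct)
  case (clique S)
  have "(`) f ` order_complex r S = {C. C \<subseteq> f ` S \<and> C \<noteq> {}}"
  proof (intro subset_antisym subsetI)
    fix C assume "C \<in> {C. C \<subseteq> f ` S \<and> C \<noteq> {}}"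
    then obtain D where "D \<subseteq> S" "C = f ` D" "D \<noteq> {}"
      by (auto simp: subset_image_iff)
    then show "C \<in> (`) f ` order_complex r S"
      using clique finite_subset[of D S] unfolding order_complex_def by (blast intro!: imageI)
  qed (auto simp: order_complex_def)
  then show ?case
    using simplex_retract_of_UNIV[of "f ` S"] clique by simp
next
  case (glue A B)
  have inj: "inj_on ((`) f) (Pow (A \<union> B))"
    using glue.prems by (rule inj_on_image_Pow)
  have sub: "order_complex r A \<subseteq> Pow (A \<union> B)" "order_complex r B \<subseteq> Pow (A \<union> B)"
    unfolding order_complex_def by auto
  have "geometric_realization ((`) f ` order_complex r (A \<inter> B))
      = geometric_realization ((`) f ` order_complex r A) \<inter> geometric_realization ((`) f ` order_complex r B)"
    by (simp add: order_complex_Int inj_on_image_Int[OF inj sub] geometric_realization_Int)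
  moreover have "inj_on f A" "inj_on f B" "inj_on f (A \<inter> B)"
    using glue.prems inj_on_subset by blast+
  ultimately show ?case
    using glue.IH retract_of_UNIV_Un
    by (simp add: order_complex_Un[OF glue.hyps(4)] image_Un geometric_realization_Un)
qed

text \<open>The numbering identifies the realization, up to homeomorphism, with a retract of a space of
  sequences; the straight-line contraction of that space, followed by the retraction \<open>q\<close>, contracts
  it.\<close>

theorem glued_from_cliques_contractible:
  assumes S: "glued_from_cliques r S"
  shows "contractible_complex (order_complex r S)"
proof -
  let ?K = "order_complex r S"
  have fin: "finite S"
    using S by (rule glued_from_cliques_finite)
  then obtain f :: "'a \<Rightarrow> nat" where f: "inj_on f S"
    using finite_imp_inj_to_nat_seg by blast
  let ?g = "inv_into S f"
  have g: "?g (f v) = v" if "v \<in> S" for v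
    using f that by simp
  let ?L = "(`) f ` ?K"
  have sub: "C \<subseteq> S" if "C \<in> ?K" for C
    using that by (simp add: order_complex_def)
  obtain q where q: "continuous_on UNIV q" "\<And>y. q y \<in> geometric_realization ?L"
      "\<And>y. y \<in> geometric_realization ?L \<Longrightarrow> q y = y"
    using glued_from_cliques_retract[OF S f] unfolding retract_of_def retraction_def by blast
  (* the homeomorphism with the numbered realization and its inverse, extended by 0 *)
  define i where "i x k = (if k \<in> f ` S then x (?g k) else 0)" for x :: "'a \<Rightarrow> real" and k
  define j where "j y v = (if v \<in> S then y (f v) else 0)" for y :: "nat \<Rightarrow> real" and v
  have cont_i: "continuous_on UNIV i"
  proof (rule continuous_on_coordinatewise_then_product)
    show "continuous_on UNIV (\<lambda>x. i x k)" for k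
      unfolding i_def by (cases "k \<in> f ` S") auto
  qed
  have cont_j: "continuous_on UNIV j"
  proof (rule continuous_on_coordinatewise_then_product)
    show "continuous_on UNIV (\<lambda>x. j x v)" for v
      unfolding j_def by (cases "v \<in> S") auto
  qed
  have j_in: "j y \<in> geometric_realization ?K" if y: "y \<in> geometric_realization ?L" for y
  proof -
    obtain C where C: "C \<in> ?K" "{k. y k \<noteq> 0} = f ` C"
      using y unfolding geometric_realization_def by auto
    have "{v. j y v \<noteq> 0} = C"
    proof -
      have "f v \<in> f ` C \<longleftrightarrow> v \<in> C" if "v \<in> S" for v
        using inj_on_image_mem_iff[OF f that sub[OF C(1)]] .
      moreover have "y k \<noteq> 0 \<longleftrightarrow> k \<in> f ` C" for k
        using C(2) by blast
      ultimately show ?thesis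
        using sub[OF C(1)] unfolding j_def by auto
    qed
    moreover have "sum y (f ` C) = sum (j y) C"
      using sub[OF C(1)] inj_on_subset[OF f]
      by (subst sum.reindex) (auto simp: j_def intro!: sum.cong)
    ultimately show ?thesis
      using y C unfolding geometric_realization_def by (auto simp: j_def)
  qed
  have i_in: "i x \<in> geometric_realization ?L" and ji: "j (i x) = x"
    if x: "x \<in> geometric_realization ?K" for x
  proof -
    have supp: "{v. x v \<noteq> 0} \<in> ?K" (is "?C \<in> _")
      using x unfolding geometric_realization_def by auto
    have "{k. i x k \<noteq> 0} = f ` ?C"
      using sub[OF supp] g unfolding i_def by force
    moreover have "sum (i x) (f ` ?C) = sum x ?C"
      using sub[OF supp] inj_on_subset[OF f] g
      by (subst sum.reindex) (auto simp: i_def intro!: sum.cong)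
    ultimately show "i x \<in> geometric_realization ?L"
      using x supp unfolding geometric_realization_def by (auto simp: i_def)
    show "j (i x) = x"
      using sub[OF supp] g by (auto simp: i_def j_def fun_eq_iff)
  qed
  have "contractible (geometric_realization ?K)"
    unfolding contractible_def
  proof
    let ?h = "\<lambda>z. j (q (\<lambda>k. (1 - fst z) * i (snd z) k))"
    have "continuous_on ({0..1} \<times> geometric_realization ?K) ?h"
    proof -
      have "continuous_on ({0..1} \<times> geometric_realization ?K) (\<lambda>z k. (1 - fst z) * i (snd z) k)"
      proof (rule continuous_on_coordinatewise_then_product)
        fix k
        have "continuous_on UNIV (\<lambda>x. i x k)"
          using cont_i by (rule continuous_on_product_then_coordinatewise)
        then have "continuous_on ({0..1} \<times> geometric_realization ?K) (\<lambda>z. i (snd z) k)"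
          by (rule continuous_on_compose2) (auto intro: continuous_intros)
        then show "continuous_on ({0..1} \<times> geometric_realization ?K) (\<lambda>z. (1 - fst z) * i (snd z) k)"
          by (intro continuous_intros)
      qed
      then have "continuous_on ({0..1} \<times> geometric_realization ?K) (\<lambda>z. q (\<lambda>k. (1 - fst z) * i (snd z) k))"
        by (rule continuous_on_compose2[OF q(1)]) auto
      then show ?thesis
        by (rule continuous_on_compose2[OF cont_j]) auto
    qed
    moreover have "?h ` ({0..1} \<times> geometric_realization ?K) \<subseteq> geometric_realization ?K"
      using j_in q(2) by auto
    moreover have "?h (0, x) = x" if "x \<in> geometric_realization ?K" for x
      using that i_in ji q(3) by simp
    moreover have "?h (1, x) = j (q (\<lambda>k. 0))" for x
      by simp
    ultimately show "homotopic_with_canon (\<lambda>x. True) (geometric_realization ?K) (geometric_realization ?K)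
        id (\<lambda>x. j (q (\<lambda>k. 0)))"
      by (subst homotopic_with) (auto intro!: exI[of _ ?h])
  qed
  moreover have "geometric_realization ?K \<noteq> {}"
    using j_in q(2) by blast
  ultimately show ?thesis
    by (simp add: contractible_complex_def)
qed

text \<open>If two vertices \<open>x\<close>, \<open>y\<close> are not adjacent, the cone is glued from the cone without \<open>x\<close> and the star
  of \<open>x\<close>, which misses \<open>y\<close>; all pieces are smaller cones with the same apex \<open>w\<close>.\<close>

lemma glued_from_cliques_cone:
  assumes "finite S" and "w \<in> S" and "\<forall>x\<in>S. r x x" and "\<forall>x\<in>S. r w x \<or> r x w"
  shows "glued_from_cliques r S"
  using assms
proof (induction "card S" arbitrary: S rule: less_induct)
  case less
  show ?case
  proof (cases "\<forall>x\<in>S. \<forall>y\<in>S. r x y \<or> r y x")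
    case True
    then show ?thesis
      using less.prems by (intro glued_from_cliques.clique) auto
  next
    case False
    then obtain x y where xy: "x \<in> S" "y \<in> S" "\<not> r x y" "\<not> r y x"
      by blast
    let ?A = "S - {x}" and ?B = "{z \<in> S. r x z \<or> r z x}"
    have "w \<noteq> x"
      using less.prems xy by auto
    have "card ?A < card S" "card ?B < card S" "card (?A \<inter> ?B) < card S"
      using xy by (blast intro: psubset_card_mono[OF less.prems(1)])+
    moreover have "w \<in> ?A" "w \<in> ?B" "w \<in> ?A \<inter> ?B"
      using less.prems xy \<open>w \<noteq> x\<close> by auto
    ultimately have "glued_from_cliques r ?A" "glued_from_cliques r ?B" "glued_from_cliques r (?A \<inter> ?B)"
      using less.prems by (auto intro!: less.hyps simp del: card_Diff_insert card_Diff_singleton)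
    then have "glued_from_cliques r (?A \<union> ?B)"
      by (rule glued_from_cliques.glue) auto
    moreover have "?A \<union> ?B = S"
      using xy less.prems by auto
    ultimately show ?thesis
      by simp
  qed
qed

text \<open>A new vertex \<open>x\<close> attaches a cone over its link.\<close>

lemma glued_from_cliques_insert:
  assumes S: "glued_from_cliques r S" and N: "glued_from_cliques r {y \<in> S. r x y \<or> r y x}"
    and x: "x \<notin> S" and refl: "\<forall>y\<in>insert x S. r y y"
  shows "glued_from_cliques r (insert x S)"
proof -
  let ?N = "{y \<in> S. r x y \<or> r y x}"
  have "glued_from_cliques r (insert x ?N)"
    using refl glued_from_cliques_finite[OF N] by (intro glued_from_cliques_cone[of _ x]) auto
  moreover have "S \<inter> insert x ?N = ?N"
    using x by auto
  ultimately have "glued_from_cliques r (S \<union> insert x ?N)"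
    using S N by (intro glued_from_cliques.glue) auto
  moreover have "S \<union> insert x ?N = insert x S"
    by auto
  ultimately show ?thesis
    by simp
qed

text \<open>A finite poset \<open>R\<close> with this property is contractible because \<open>y \<mapsto> y \<and> b\<close> is a monotone map below the identity whose image
  has the greatest element \<open>b\<close>.\<close>

definition meets_with_element :: "('a \<Rightarrow> 'a \<Rightarrow> bool) \<Rightarrow> 'a set \<Rightarrow> bool" where
  "meets_with_element r R \<longleftrightarrow>
     (\<exists>b\<in>R. \<forall>y\<in>R. \<exists>z\<in>R. r z y \<and> r z b \<and> (\<forall>w\<in>R. r w y \<and> r w b \<longrightarrow> r w z))"

lemma minimal_element:
  assumes "finite A" "A \<noteq> {}" "transp_on A r" "antisymp_on A r"
  obtains x where "x \<in> A" "\<And>y. y \<in> A \<Longrightarrow> r y x \<Longrightarrow> y = x"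
proof -
  let ?s = "\<lambda>x y. r x y \<and> x \<noteq> y"
  have "asymp_on A ?s"
    using assms(4) by (auto simp: asymp_on_def antisymp_on_def)
  moreover have "transp_on A ?s"
  proof (rule transp_onI)
    fix x y z assume "x \<in> A" "y \<in> A" "z \<in> A" "?s x y" "?s y z"
    then show "?s x z"
      using assms(3,4) by (metis transp_onD antisymp_onD)
  qed
  ultimately have "\<exists>m\<in>A. \<forall>x\<in>A. x \<noteq> m \<longrightarrow> \<not> ?s x m"
    using assms(1,2) by (intro Finite_Set.bex_min_element)
  then show thesis
    using that by blast
qed

text \<open>Let \<open>b\<close> be the element with which meets exist.  The elements of \<open>R\<close> below \<open>b\<close> together with \<open>L\<close> form a cone with apex \<open>b\<close>.  The other elements
  \<open>x\<close> of \<open>R\<close> are attached from the top downwards.  The link of \<open>x\<close> then consists of elements above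
  \<open>x\<close>, of elements below both \<open>x\<close> and \<open>b\<close>, and of \<open>L\<close>, so it is a cone with apex the meet of \<open>x\<close>
  and \<open>b\<close>.\<close>

lemma glued_from_cliques_join:
  assumes fin: "finite L" "finite R" and refl: "\<forall>x\<in>L \<union> R. r x x"
    and join: "\<forall>x\<in>L. \<forall>y\<in>R. r x y \<or> r y x"
    and trans: "transp_on R r" and anti: "antisymp_on R r"
    and meets: "meets_with_element r R"
  shows "glued_from_cliques r (L \<union> R)"
proof -
  obtain b where b: "b \<in> R"
    and meet: "\<And>y. y \<in> R \<Longrightarrow> \<exists>z\<in>R. r z y \<and> r z b \<and> (\<forall>w\<in>R. r w y \<and> r w b \<longrightarrow> r w z)"
    using meets unfolding meets_with_element_def by blast
  let ?R = "{y \<in> R. r y b}"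
  (* T grows from the elements below b to all of R by adding elements from the top downwards *)
  have "glued_from_cliques r (L \<union> T)"
    if "?R \<subseteq> T" "T \<subseteq> R" "\<And>x y. \<lbrakk>x \<in> T - ?R; y \<in> R; r x y\<rbrakk> \<Longrightarrow> y \<in> T" for T
    using that
  proof (induction "card T" arbitrary: T rule: less_induct)
    case less
    have finT: "finite T"
      using less.prems(2) fin(2) finite_subset by blast
    show ?case
    proof (cases "T - ?R = {}")
      case True
      then have "T = ?R"
        using less.prems by auto
      then show ?thesis
        using fin finT refl join b by (intro glued_from_cliques_cone[of _ b]) auto
    next
      case False
      obtain x where x: "x \<in> T - ?R" and x_min: "\<And>y. y \<in> T - ?R \<Longrightarrow> r y x \<Longrightarrow> y = x"
      proof (rule minimal_element[of "T - ?R" r])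
        show "transp_on (T - ?R) r" "antisymp_on (T - ?R) r"
          using less.prems(2) trans anti by (auto elim!: transp_on_subset antisymp_on_subset)
      qed (use False finT in auto)
      have T': "glued_from_cliques r (L \<union> (T - {x}))"
      proof (rule less.hyps)
        show "card (T - {x}) < card T"
          using x finT by (intro card_Diff1_less) auto
        show "?R \<subseteq> T - {x}" "T - {x} \<subseteq> R"
          using less.prems x by auto
        show "y \<in> T - {x}" if "u \<in> T - {x} - ?R" "y \<in> R" "r u y" for u y
          using less.prems(3)[of u y] x_min[of u] that by auto
      qed
      show ?thesis
      proof (cases "x \<in> L")
        case True
        then have "L \<union> T = L \<union> (T - {x})"
          by auto
        then show ?thesis
          using T' by simp
      next
        case False
        have xR: "x \<in> R"
          using x less.prems by auto
        then obtain z where z: "z \<in> R" "r z x" "r z b" "\<And>w. w \<in> R \<Longrightarrow> r w x \<Longrightarrow> r w b \<Longrightarrow> r w z"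
          using meet by blast
        let ?N = "{y \<in> L \<union> (T - {x}). r x y \<or> r y x}"
        have "glued_from_cliques r ?N"
        proof (rule glued_from_cliques_cone[of _ z])
          show "z \<in> ?N"
            using z x less.prems(1) by auto
          show "\<forall>y\<in>?N. r z y \<or> r y z"
          proof
            fix y assume y: "y \<in> ?N"
            show "r z y \<or> r y z"
            proof (cases "y \<in> L")
              case True
              then show ?thesis
                using join z by blast
            next
              case False
              then have yT: "y \<in> T" "y \<noteq> x" "y \<in> R"
                using y less.prems(2) by auto
              show ?thesis
              proof (cases "r x y")
                case True
                then show ?thesis
                  using transp_onD[OF trans z(1) xR yT(3) z(2)] by simp
              next
                case False
                then show ?thesis
                  using y yT x_min[of y] z(4)[of y] by blast
              qed
            qed
          qed
        qed (use fin finT refl less.prems(2) in auto)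
        moreover have "insert x (L \<union> (T - {x})) = L \<union> T"
          using x by auto
        ultimately show ?thesis
          using glued_from_cliques_insert[OF T', of x] False refl less.prems(2) x by auto
      qed
    qed
  qed
  from this[of R] show ?thesis
    by auto
qed

section \<open>The chains compatible with a convex part of a poset\<close>

text \<open>Let \<open>M\<close> be a convex part of a finite poset.  The chains that stay chains after some element of \<open>M\<close> is
  added form the union of the stars of the vertices in \<open>M\<close>.\<close>

locale convex_part =
  fixes le :: "'a \<Rightarrow> 'a \<Rightarrow> bool" (infix \<open>\<preceq>\<close> 50) and X M :: "'a set"
  assumes finite: "finite X"
    and refl: "x \<in> X \<Longrightarrow> x \<preceq> x"
    and trans: "\<lbrakk>x \<in> X; y \<in> X; z \<in> X; x \<preceq> y; y \<preceq> z\<rbrakk> \<Longrightarrow> x \<preceq> z"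
    and antisym: "\<lbrakk>x \<in> X; y \<in> X; x \<preceq> y; y \<preceq> x\<rbrakk> \<Longrightarrow> x = y"
    and subset: "M \<subseteq> X"
    and convex: "\<lbrakk>m \<in> M; m' \<in> M; y \<in> X; m \<preceq> y; y \<preceq> m'\<rbrakk> \<Longrightarrow> y \<in> M"
begin

definition compatible_chains :: "'a set set" where
  "compatible_chains = {C \<in> order_complex (\<preceq>) X. \<exists>m\<in>M. insert m C \<in> order_complex (\<preceq>) X}"

definition compatible :: "'a \<Rightarrow> 'a \<Rightarrow> bool" where
  "compatible x y \<longleftrightarrow> x \<preceq> y \<and> (\<exists>m\<in>M. (m \<preceq> x \<or> x \<preceq> m) \<and> (m \<preceq> y \<or> y \<preceq> m))"

definition upper :: "'a set" where
  "upper = {y \<in> X. \<exists>m\<in>M. m \<preceq> y}"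

definition lower :: "'a set" where
  "lower = {x \<in> X. x \<notin> upper \<and> (\<exists>m\<in>M. x \<preceq> m)}"

definition upper_above :: "'a \<Rightarrow> 'a set" where
  "upper_above x = {y \<in> X. \<exists>m\<in>M. x \<preceq> m \<and> m \<preceq> y}"

lemma upper_above_subset: "upper_above x \<subseteq> upper"
  unfolding upper_above_def upper_def by blast

lemma compatible_upper:
  assumes "x \<in> upper" "y \<in> upper"
  shows "compatible x y \<longleftrightarrow> x \<preceq> y"
  using assms trans subset unfolding compatible_def upper_def by blast

lemma compatible_lower:
  assumes "x \<in> lower" "y \<in> lower"
  shows "compatible x y \<longleftrightarrow> x \<preceq> y"
  using assms trans subset unfolding compatible_def lower_def by blast

text \<open>An element of \<open>M\<close> comparable with both \<open>x\<close> and \<open>y\<close> can be taken between them: it cannot lie below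
  \<open>x\<close>, and if it lies above \<open>y\<close>, then \<open>y\<close> itself belongs to \<open>M\<close> by convexity.\<close>

lemma lower_upper_comparable:
  assumes x: "x \<in> lower" and y: "y \<in> upper"
  shows "compatible x y \<or> compatible y x \<longleftrightarrow> y \<in> upper_above x"
proof
  have XY: "x \<in> X" "y \<in> X" and not_up: "\<And>m. m \<in> M \<Longrightarrow> \<not> m \<preceq> x"
    using x y by (auto simp: lower_def upper_def)
  assume "compatible x y \<or> compatible y x"
  then obtain m where m: "m \<in> M" "m \<preceq> x \<or> x \<preceq> m" "m \<preceq> y \<or> y \<preceq> m" and xy: "x \<preceq> y \<or> y \<preceq> x"
    unfolding compatible_def by blast
  obtain m' where m': "m' \<in> M" "m' \<preceq> y"
    using y by (auto simp: upper_def)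
  have "\<not> y \<preceq> x"
    using not_up m' trans[of m' y x] XY subset by blast
  then have "x \<preceq> y"
    using xy by blast
  have "x \<preceq> m"
    using m not_up by blast
  show "y \<in> upper_above x"
  proof (cases "m \<preceq> y")
    case True
    then show ?thesis
      using XY m \<open>x \<preceq> m\<close> by (auto simp: upper_above_def)
  next
    case False
    then have "y \<in> M"
      using m m' convex XY by blast
    then show ?thesis
      using XY \<open>x \<preceq> y\<close> refl by (auto simp: upper_above_def)
  qed
next
  assume "y \<in> upper_above x"
  then show "compatible x y \<or> compatible y x"
    using x subset trans[of x _ y] unfolding upper_above_def compatible_def lower_def by blast
qed

lemma transp_on_subset_X: "C \<subseteq> X \<Longrightarrow> transp_on C (\<preceq>)" "C \<subseteq> X \<Longrightarrow> transp_on C (\<lambda>x y. y \<preceq> x)"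
  using trans unfolding transp_on_def by (meson subsetD)+

lemma antisymp_on_subset_X: "C \<subseteq> X \<Longrightarrow> antisymp_on C (\<preceq>)" "C \<subseteq> X \<Longrightarrow> antisymp_on C (\<lambda>x y. y \<preceq> x)"
  using antisym unfolding antisymp_on_def by (meson subsetD)+

lemma least_of_chain:
  assumes "C \<subseteq> X" "C \<noteq> {}" "\<forall>x\<in>C. \<forall>y\<in>C. x \<preceq> y \<or> y \<preceq> x"
  obtains x where "x \<in> C" "\<And>y. y \<in> C \<Longrightarrow> x \<preceq> y"
proof (rule minimal_element[of C "(\<preceq>)"])
  show "finite C"
    using assms finite finite_subset by blast
  show "transp_on C (\<preceq>)" "antisymp_on C (\<preceq>)"
    using assms(1) by (rule transp_on_subset_X antisymp_on_subset_X)+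
qed (use assms that in blast)+

lemma greatest_of_chain:
  assumes "C \<subseteq> X" "C \<noteq> {}" "\<forall>x\<in>C. \<forall>y\<in>C. x \<preceq> y \<or> y \<preceq> x"
  obtains x where "x \<in> C" "\<And>y. y \<in> C \<Longrightarrow> y \<preceq> x"
proof (rule minimal_element[of C "\<lambda>x y. y \<preceq> x"])
  show "finite C"
    using assms finite finite_subset by blast
  show "transp_on C (\<lambda>x y. y \<preceq> x)" "antisymp_on C (\<lambda>x y. y \<preceq> x)"
    using assms(1) by (rule transp_on_subset_X antisymp_on_subset_X)+
qed (use assms that in blast)+

text \<open>Compatibility of pairs suffices: for a chain that meets both parts, an element of \<open>M\<close> between
  its greatest lower element and its least upper element is comparable with the whole chain.\<close>

lemma compatible_chains_eq: "compatible_chains = order_complex compatible (lower \<union> upper)"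
proof (intro subset_antisym subsetI)
  fix C assume "C \<in> compatible_chains"
  then obtain m where C: "C \<in> order_complex (\<preceq>) X" and m: "m \<in> M" "insert m C \<in> order_complex (\<preceq>) X"
    unfolding compatible_chains_def by blast
  have cmp: "m \<preceq> x \<or> x \<preceq> m" if "x \<in> C" for x
    using m that unfolding order_complex_def by auto
  have CX: "C \<subseteq> X" "finite C" "C \<noteq> {}" and chain: "\<And>x y. \<lbrakk>x \<in> C; y \<in> C\<rbrakk> \<Longrightarrow> x \<preceq> y \<or> y \<preceq> x"
    using C unfolding order_complex_def by auto
  have "x \<in> lower \<union> upper" if "x \<in> C" for x
    using cmp[OF that] that m(1) CX(1) unfolding lower_def upper_def by auto
  moreover have "compatible x y \<or> compatible y x" if "x \<in> C" "y \<in> C" for x y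
    using chain[OF that] cmp[OF that(1)] cmp[OF that(2)] m(1) unfolding compatible_def by auto
  ultimately show "C \<in> order_complex compatible (lower \<union> upper)"
    using CX unfolding order_complex_def by auto
next
  fix C assume "C \<in> order_complex compatible (lower \<union> upper)"
  then have C: "C \<subseteq> lower \<union> upper" "finite C" "C \<noteq> {}"
    and comp: "\<And>x y. \<lbrakk>x \<in> C; y \<in> C\<rbrakk> \<Longrightarrow> compatible x y \<or> compatible y x"
    unfolding order_complex_def by blast+
  have CX: "C \<subseteq> X"
    using C by (auto simp: lower_def upper_def)
  have chain: "\<forall>x\<in>C. \<forall>y\<in>C. x \<preceq> y \<or> y \<preceq> x"
    using comp unfolding compatible_def by blast
  let ?L = "C \<inter> lower" and ?U = "C \<inter> upper"
  have "\<exists>m\<in>M. (\<forall>x\<in>?L. x \<preceq> m) \<and> (\<forall>y\<in>?U. m \<preceq> y)"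
  proof (cases "?L = {}")
    case True
    then have "?U \<noteq> {}"
      using C by blast
    then obtain u where u: "u \<in> ?U" "\<And>y. y \<in> ?U \<Longrightarrow> u \<preceq> y"
      using least_of_chain[of ?U] chain CX by blast
    then obtain m where "m \<in> M" "m \<preceq> u"
      by (auto simp: upper_def)
    then show ?thesis
      using True u subset CX by (metis Int_iff subsetD trans empty_iff)
  next
    case False
    then obtain l where l: "l \<in> ?L" "\<And>x. x \<in> ?L \<Longrightarrow> x \<preceq> l"
      using greatest_of_chain[of ?L] chain CX by blast
    show ?thesis
    proof (cases "?U = {}")
      case True
      obtain m where "m \<in> M" "l \<preceq> m"
        using l by (auto simp: lower_def)
      then show ?thesis
        using True l subset CX by (metis Int_iff subsetD trans empty_iff)
    next
      case False
      then obtain u where u: "u \<in> ?U" "\<And>y. y \<in> ?U \<Longrightarrow> u \<preceq> y"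
        using least_of_chain[of ?U] chain CX by blast
      then have "u \<in> upper_above l"
        using l comp lower_upper_comparable by blast
      then obtain m where "m \<in> M" "l \<preceq> m" "m \<preceq> u"
        by (auto simp: upper_above_def)
      then show ?thesis
        using l u subset CX by (metis Int_iff subsetD trans)
    qed
  qed
  then obtain m where m: "m \<in> M" "\<And>x. x \<in> ?L \<Longrightarrow> x \<preceq> m" "\<And>y. y \<in> ?U \<Longrightarrow> m \<preceq> y"
    by blast
  then have "m \<preceq> x \<or> x \<preceq> m" if "x \<in> C" for x
    using that C by blast
  then have "insert m C \<in> order_complex (\<preceq>) X"
    using m(1) subset CX C chain refl unfolding order_complex_def by blast
  then show "C \<in> compatible_chains"
    using m(1) CX C chain unfolding compatible_chains_def order_complex_def by blast
qed

lemma meets_with_element_compatible: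
  assumes "R \<subseteq> upper" and "meets_with_element (\<preceq>) R"
  shows "meets_with_element compatible R"
proof -
  have "compatible x y \<longleftrightarrow> x \<preceq> y" if "x \<in> R" "y \<in> R" for x y
    using that assms(1) compatible_upper by blast
  then show ?thesis
    using assms(2) unfolding meets_with_element_def by (metis (no_types, lifting))
qed

lemma glued_from_cliques_join_upper:
  assumes L: "L \<subseteq> lower" and R: "R \<subseteq> upper" "meets_with_element (\<preceq>) R"
    and join: "\<forall>x\<in>L. R \<subseteq> upper_above x"
  shows "glued_from_cliques compatible (L \<union> R)"
proof (rule glued_from_cliques_join)
  have sub: "L \<subseteq> X" "R \<subseteq> X"
    using L R unfolding lower_def upper_def by blast+
  then show "finite L" "finite R"
    using finite finite_subset by blast+
  show "\<forall>x\<in>L \<union> R. compatible x x"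
    using L R(1) sub refl compatible_upper compatible_lower by blast
  show "\<forall>x\<in>L. \<forall>y\<in>R. compatible x y \<or> compatible y x"
    using L R(1) join lower_upper_comparable by blast
  have eq: "compatible x y \<longleftrightarrow> x \<preceq> y" if "x \<in> R" "y \<in> R" for x y
    using that R(1) compatible_upper by blast
  show "transp_on R compatible"
    using transp_on_subset_X(1)[OF sub(2)] eq unfolding transp_on_def by blast
  show "antisymp_on R compatible"
    using antisymp_on_subset_X(1)[OF sub(2)] eq unfolding antisymp_on_def by blast
  show "meets_with_element compatible R"
    using R by (rule meets_with_element_compatible)
qed

text \<open>The upper part is contractible by hypothesis.  The elements \<open>x\<close> of the lower part are attached in
  increasing order.  The link of \<open>x\<close> is then the join of the lower elements below \<open>x\<close> with
  \<open>upper_above x\<close>, and a join with a contractible factor is contractible.\<close>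

theorem contractible_compatible_chains:
  assumes upper: "meets_with_element (\<preceq>) upper"
    and above: "\<And>x. x \<in> lower \<Longrightarrow> meets_with_element (\<preceq>) (upper_above x)"
  shows "contractible_complex compatible_chains"
proof -
  have fin: "finite lower"
    using finite unfolding lower_def by simp
  (* D grows from the empty set to the lower part by adding elements from the bottom upwards *)
  have "glued_from_cliques compatible (upper \<union> D)"
    if "D \<subseteq> lower" "\<And>x y. \<lbrakk>x \<in> D; y \<in> lower; y \<preceq> x\<rbrakk> \<Longrightarrow> y \<in> D" for D
    using that
  proof (induction "card D" arbitrary: D rule: less_induct)
    case less
    have finD: "finite D"
      using less.prems(1) fin finite_subset by blast
    have DX: "D \<subseteq> X"
      using less.prems(1) by (auto simp: lower_def)
    show ?case
    proof (cases "D = {}")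
      case True
      then show ?thesis
        using glued_from_cliques_join_upper[of "{}" upper] upper by simp
    next
      case False
      obtain x where x: "x \<in> D" and x_max: "\<And>y. y \<in> D \<Longrightarrow> x \<preceq> y \<Longrightarrow> y = x"
      proof (rule minimal_element[of D "\<lambda>x y. y \<preceq> x"])
        show "transp_on D (\<lambda>x y. y \<preceq> x)" "antisymp_on D (\<lambda>x y. y \<preceq> x)"
          using DX by (rule transp_on_subset_X antisymp_on_subset_X)+
      qed (use False finD in auto)
      have x_low: "x \<in> lower"
        using x less.prems(1) by blast
      have D': "glued_from_cliques compatible (upper \<union> (D - {x}))"
      proof (rule less.hyps)
        show "card (D - {x}) < card D"
          using x finD by (intro card_Diff1_less) auto
        show "D - {x} \<subseteq> lower"
          using less.prems(1) by blast
        show "y \<in> D - {x}" if "u \<in> D - {x}" "y \<in> lower" "y \<preceq> u" for u y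
          using that less.prems(2)[of u y] x_max[of u] by blast
      qed
      let ?L = "{y \<in> D - {x}. y \<preceq> x}"
      have N: "{y \<in> upper \<union> (D - {x}). compatible x y \<or> compatible y x} = ?L \<union> upper_above x"
        using x_low x_max less.prems(1) lower_upper_comparable[OF x_low] compatible_lower
          upper_above_subset by blast
      have "glued_from_cliques compatible (?L \<union> upper_above x)"
      proof (rule glued_from_cliques_join_upper)
        show "?L \<subseteq> lower"
          using less.prems(1) by blast
        show "\<forall>y\<in>?L. upper_above x \<subseteq> upper_above y"
          using DX x subset trans unfolding upper_above_def by blast
      qed (use above x_low upper_above_subset in auto)
      then have "glued_from_cliques compatible (insert x (upper \<union> (D - {x})))"
      proof (intro glued_from_cliques_insert[OF D'])
        show "x \<notin> upper \<union> (D - {x})"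
          using x_low by (auto simp: lower_def)
        have "y \<preceq> y" if "y \<in> upper \<or> y \<in> lower" for y
          using that refl unfolding upper_def lower_def by blast
        then have "compatible y y" if "y \<in> upper \<or> y \<in> lower" for y
          using that compatible_upper[of y y] compatible_lower[of y y] by blast
        then show "\<forall>y\<in>insert x (upper \<union> (D - {x})). compatible y y"
          using less.prems(1) x_low by auto
      qed (simp only: N)
      moreover have "insert x (upper \<union> (D - {x})) = upper \<union> D"
        using x by auto
      ultimately show ?thesis
        by simp
    qed
  qed
  from this[of lower] have "glued_from_cliques compatible (lower \<union> upper)"
    by (simp add: Un_commute)
  then show ?thesis
    unfolding compatible_chains_eq by (rule glued_from_cliques_contractible)
qed

end

section \<open>Points in convex position, listed clockwise\<close>

text \<open>The determinant of \<open>q - p\<close> and \<open>r - p\<close>; it is negative if \<open>p\<close>, \<open>q\<close>, \<open>r\<close> run clockwise.\<close>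

definition orient :: "complex \<Rightarrow> complex \<Rightarrow> complex \<Rightarrow> real" where
  "orient p q r = Im (cnj (q - p) * (r - p))"

lemma orient_rotate: "orient q r p = orient p q r"
  unfolding orient_def by (simp add: algebra_simps)

lemma orient_swap: "orient p r q = - orient p q r"
  unfolding orient_def by (simp add: algebra_simps)

lemma orient_flip: "orient q p r = - orient p q r"
  unfolding orient_def by (simp add: algebra_simps)

lemma orient_degenerate [simp]: "orient p q p = 0" "orient p q q = 0" "orient p p q = 0"
  unfolding orient_def by (simp_all add: algebra_simps)

lemma orient_affine:
  assumes "u + v = 1"
  shows "orient p q (u *\<^sub>R x + v *\<^sub>R y) = u * orient p q x + v * orient p q y"
proof -
  have u: "u = 1 - v"
    using assms by simp
  show ?thesis
    unfolding orient_def u by (simp add: algebra_simps)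
qed

lemma disjnt_convex_hulls_by_line:
  assumes "\<And>x. x \<in> A \<Longrightarrow> 0 \<le> orient p q x" and "\<And>x. x \<in> B \<Longrightarrow> orient p q x < 0"
  shows "disjnt (convex hull A) (convex hull B)"
proof -
  have "convex {x. 0 \<le> orient p q x}"
    unfolding convex_def by (auto simp: orient_affine)
  then have "convex hull A \<subseteq> {x. 0 \<le> orient p q x}"
    using assms(1) by (intro hull_minimal) auto
  moreover have "convex {x. orient p q x < 0}"
    unfolding convex_def
  proof (intro ballI allI impI, clarsimp)
    fix x y and u v :: real
    assume xy: "orient p q x < 0" "orient p q y < 0" and uv: "0 \<le> u" "0 \<le> v" "u + v = 1"
    have "u * orient p q x \<le> 0" "v * orient p q y \<le> 0"
      using xy uv by (auto simp: mult_nonneg_nonpos)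
    moreover have "u * orient p q x < 0 \<or> v * orient p q y < 0"
      using xy uv by (cases "u = 0") (auto simp: mult_pos_neg)
    ultimately show "orient p q (u *\<^sub>R x + v *\<^sub>R y) < 0"
      using uv(3) by (auto simp: orient_affine)
  qed
  then have "convex hull B \<subseteq> {x. orient p q x < 0}"
    using assms(2) by (intro hull_minimal) auto
  ultimately show ?thesis
    unfolding disjnt_def by fastforce
qed

text \<open>Convex position enters only through the signs of the determinants of triples of vertices.\<close>

locale clockwise_polygon =
  fixes V :: "complex set" and pos :: "complex \<Rightarrow> nat"
  assumes finite_V: "finite V"
    and inj_pos: "inj_on pos V"
    and clockwise: "\<lbrakk>p \<in> V; q \<in> V; r \<in> V; pos p < pos q; pos q < pos r\<rbrakk> \<Longrightarrow> orient p q r < 0"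
begin

lemma pos_eq: "\<lbrakk>p \<in> V; q \<in> V; pos p = pos q\<rbrakk> \<Longrightarrow> p = q"
  using inj_pos by (auto dest: inj_onD)

lemma pos_least:
  assumes "B \<noteq> {}"
  obtains v where "v \<in> B" "\<And>u. u \<in> B \<Longrightarrow> pos v \<le> pos u"
  using assms ex_has_least_nat[of "\<lambda>v. v \<in> B" _ pos] by blast

lemma pos_greatest:
  assumes "B \<noteq> {}" "B \<subseteq> V"
  obtains v where "v \<in> B" "\<And>u. u \<in> B \<Longrightarrow> pos u \<le> pos v"
proof -
  have fin: "finite (pos ` B)"
    using assms(2) finite_V finite_subset by blast
  then obtain v where "v \<in> B" "pos v = Max (pos ` B)"
    using Max_in[OF fin] assms(1) by (metis imageE image_is_empty)
  then show thesis
    using that[of v] Max_ge[OF fin] by auto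
qed

lemma orient_between:
  assumes "p \<in> V" "q \<in> V" "r \<in> V" "pos p \<le> pos r" "pos r \<le> pos q"
  shows "0 \<le> orient p q r"
proof (cases "r = p \<or> r = q")
  case False
  then have "pos p < pos r" "pos r < pos q"
    using assms pos_eq by (metis le_neq_implies_less)+
  then show ?thesis
    using clockwise[of p r q] assms orient_swap[of p q r] by simp
qed auto

lemma orient_beyond:
  assumes "p \<in> V" "q \<in> V" "r \<in> V" "pos p < pos q" "pos r < pos p \<or> pos q < pos r"
  shows "orient p q r < 0"
  using assms clockwise orient_rotate by metis

text \<open>Only the pattern that begins in \<open>A\<close> counts, so this is not symmetric in \<open>A\<close> and \<open>B\<close>.\<close>

definition crosses :: "complex set \<Rightarrow> complex set \<Rightarrow> bool" where
  "crosses A B \<longleftrightarrow> (\<exists>p\<in>A. \<exists>q\<in>B. \<exists>r\<in>A. \<exists>s\<in>B. pos p < pos q \<and> pos q < pos r \<and> pos r < pos s)"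

lemma crosses_mono: "\<lbrakk>crosses A B; A \<subseteq> A'; B \<subseteq> B'\<rbrakk> \<Longrightarrow> crosses A' B'"
  unfolding crosses_def by blast

text \<open>The diagonals \<open>pr\<close> and \<open>qs\<close> of a convex quadrangle meet.  The four determinants are the
  coefficients of the affine dependence between its corners, which exhibits the common point.\<close>

lemma convex_hulls_meet:
  assumes "A \<subseteq> V" "B \<subseteq> V" "crosses A B"
  shows "\<not> disjnt (convex hull A) (convex hull B)"
proof -
  obtain p q r s where mem: "p \<in> A" "q \<in> B" "r \<in> A" "s \<in> B"
    and lt: "pos p < pos q" "pos q < pos r" "pos r < pos s"
    using assms(3) unfolding crosses_def by blast
  have V: "p \<in> V" "q \<in> V" "r \<in> V" "s \<in> V"
    using mem assms(1,2) by auto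
  let ?a = "orient q r s" and ?b = "orient p q s" and ?c = "orient p r s" and ?d = "orient p q r"
  have neg: "?a < 0" "?b < 0" "?c < 0" "?d < 0"
    using clockwise V lt by (meson order.strict_trans)+
  have sum_eq: "?a + ?b = ?c + ?d"
    unfolding orient_def by (simp add: algebra_simps)
  have "?a *\<^sub>R p + ?b *\<^sub>R r = ?c *\<^sub>R q + ?d *\<^sub>R s"
    unfolding orient_def by (simp add: complex_eq_iff algebra_simps)
  then have z: "(?a / (?a + ?b)) *\<^sub>R p + (?b / (?a + ?b)) *\<^sub>R r
      = (?c / (?c + ?d)) *\<^sub>R q + (?d / (?c + ?d)) *\<^sub>R s"
    unfolding sum_eq[symmetric]
    by (metis (no_types, opaque_lifting) divide_inverse mult.commute scaleR_add_right scaleR_scaleR)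
  have "(?a / (?a + ?b)) *\<^sub>R p + (?b / (?a + ?b)) *\<^sub>R r \<in> convex hull A"
    using mem neg by (intro convexD[OF convex_convex_hull] hull_inc)
      (auto simp: add_divide_distrib[symmetric] intro!: divide_nonpos_nonpos)
  moreover have "(?c / (?c + ?d)) *\<^sub>R q + (?d / (?c + ?d)) *\<^sub>R s \<in> convex hull B"
    using mem neg by (intro convexD[OF convex_convex_hull] hull_inc)
      (auto simp: add_divide_distrib[symmetric] intro!: divide_nonpos_nonpos)
  ultimately show ?thesis
    using z unfolding disjnt_def by auto
qed

text \<open>The second alternative is the step from the last point of \<open>B\<close> back to the first one; for a single
  point it makes the point its own successor.\<close>

definition is_next :: "complex set \<Rightarrow> complex \<Rightarrow> complex \<Rightarrow> bool" where
  "is_next B v w \<longleftrightarrow> v \<in> B \<and> w \<in> B \<and>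
     (pos v < pos w \<and> (\<forall>u\<in>B. pos u \<le> pos v \<or> pos w \<le> pos u) \<or>
      (\<forall>u\<in>B. pos w \<le> pos u \<and> pos u \<le> pos v))"

lemma is_next_exists:
  assumes "v \<in> B" "B \<subseteq> V"
  obtains w where "is_next B v w"
proof (cases "\<exists>u\<in>B. pos v < pos u")
  case True
  then obtain w where "w \<in> {u \<in> B. pos v < pos u}" "\<And>u. u \<in> {u \<in> B. pos v < pos u} \<Longrightarrow> pos w \<le> pos u"
    using pos_least[of "{u \<in> B. pos v < pos u}"] by blast
  then have "is_next B v w"
    using assms unfolding is_next_def by (auto simp: not_less)
  then show thesis
    by (rule that)
next
  case False
  obtain w where "w \<in> B" "\<And>u. u \<in> B \<Longrightarrow> pos w \<le> pos u"
    using pos_least assms by blast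
  then have "is_next B v w"
    using assms False unfolding is_next_def by (auto simp: not_less)
  then show thesis
    by (rule that)
qed

lemma is_next_injective:
  assumes "B \<subseteq> V" "is_next B v w" "is_next B v' w"
  shows "v = v'"
proof -
  have "v \<in> B" "v' \<in> B" "w \<in> B"
    using assms unfolding is_next_def by auto
  moreover have "pos v = pos v'"
    using assms(2,3) calculation unfolding is_next_def by (meson le_antisym leD)
  ultimately show ?thesis
    using pos_eq assms(1) by blast
qed

lemma clockwise_next_eq:
  assumes "B \<subseteq> V" "is_next B v w"
  shows "clockwise_next B v = w"
proof -
  have vw: "v \<in> B" "w \<in> B" "v \<in> V" "w \<in> V"
    using assms unfolding is_next_def by auto
  show ?thesis
  proof (cases "w = v")
    case True
    then have "pos u = pos v" if "u \<in> B" for u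
      using assms(2) that unfolding is_next_def by (meson le_antisym less_irrefl)
    then have "B = {v}"
      using pos_eq assms(1) vw by blast
    then show ?thesis
      using True by (simp add: clockwise_next_def)
  next
    case False
    have right: "orient v w u < 0" if u: "u \<in> B - {v, w}" for u
    proof -
      have uV: "u \<in> V"
        using u assms(1) by blast
      have ne: "pos u \<noteq> pos v" "pos u \<noteq> pos w"
        using u uV vw pos_eq[of u v] pos_eq[of u w] by auto
      show ?thesis
      proof (cases "pos v < pos w")
        case True
        then have "pos u \<le> pos v \<or> pos w \<le> pos u"
          using assms(2) u vw unfolding is_next_def by (meson DiffD1 le_trans not_le)
        then have "pos u < pos v \<or> pos w < pos u"
          using ne by auto
        then show ?thesis
          using orient_beyond[OF vw(3,4) uV True] by blast
      next
        case False
        then have "pos w \<le> pos u \<and> pos u \<le> pos v"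
          using assms(2) u unfolding is_next_def by blast
        then have "orient w u v < 0"
          using clockwise vw uV ne by (metis le_neq_implies_less)
        then show ?thesis
          by (metis orient_rotate)
      qed
    qed
    have "(THE w. w \<in> B \<and> w \<noteq> v \<and> (\<forall>u\<in>B - {v, w}. Im (cnj (w - v) * (u - v)) < 0)) = w"
    proof (rule the_equality)
      show "w \<in> B \<and> w \<noteq> v \<and> (\<forall>u\<in>B - {v, w}. Im (cnj (w - v) * (u - v)) < 0)"
        using vw False right unfolding orient_def by blast
      show "x = w" if x: "x \<in> B \<and> x \<noteq> v \<and> (\<forall>u\<in>B - {v, x}. Im (cnj (x - v) * (u - v)) < 0)" for x
      proof (rule ccontr)
        assume "x \<noteq> w"
        then have "orient v x w < 0" "orient v w x < 0"
          using x vw False right[of x] unfolding orient_def by auto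
        then show False
          using orient_swap[of v x w] by simp
      qed
    qed
    moreover have "B \<noteq> {v}"
      using vw False by auto
    ultimately show ?thesis
      unfolding clockwise_next_def by simp
  qed
qed

text \<open>A set \<open>Y\<close> that does not cross \<open>X\<close> lies in one gap between cyclically consecutive points \<open>x'\<close> and \<open>x\<close>
  of \<open>X\<close>.  Since \<open>X\<close> starts first, either the gap is inside the list, or \<open>Y\<close> follows all of
  \<open>X\<close> and the gap wraps around.\<close>

lemma block_in_gap:
  assumes XY: "X \<subseteq> V" "Y \<subseteq> V" "X \<inter> Y = {}" and ne: "Y \<noteq> {}" and nc: "\<not> crosses X Y"
    and x0: "x0 \<in> X" "\<And>u. u \<in> Y \<Longrightarrow> pos x0 < pos u"
  obtains x' x y y' where "is_next X x' x" "y \<in> Y" "y' \<in> Y"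
    "\<forall>u\<in>Y. pos y \<le> pos u \<and> pos u \<le> pos y'" "\<forall>u\<in>Y. pos x' < pos u"
    "pos x \<le> pos x' \<or> (\<forall>u\<in>Y. pos u < pos x)"
proof -
  obtain y where y: "y \<in> Y" "\<And>u. u \<in> Y \<Longrightarrow> pos y \<le> pos u"
    using pos_least ne by blast
  obtain y' where y': "y' \<in> Y" "\<And>u. u \<in> Y \<Longrightarrow> pos u \<le> pos y'"
    using pos_greatest ne XY by blast
  obtain x' where x': "x' \<in> X" "pos x' < pos y" "\<And>u. u \<in> X \<Longrightarrow> pos u < pos y \<Longrightarrow> pos u \<le> pos x'"
  proof -
    have "{u \<in> X. pos u < pos y} \<noteq> {}" "{u \<in> X. pos u < pos y} \<subseteq> V"
      using x0 y XY(1) by blast+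
    then show thesis
      using that by (rule pos_greatest) auto
  qed
  have ne_y: "pos u \<noteq> pos w" if "u \<in> X" "w \<in> Y" for u w
    using that XY pos_eq by (metis IntI empty_iff subsetD)
  have below: "pos x' < pos u" if "u \<in> Y" for u
    using x'(2) y(2)[OF that] by simp
  show thesis
  proof (cases "\<exists>u\<in>X. pos y < pos u")
    case True
    then obtain x where x: "x \<in> X" "pos y < pos x" "\<And>u. u \<in> X \<Longrightarrow> pos y < pos u \<Longrightarrow> pos x \<le> pos u"
    proof -
      have "{u \<in> X. pos y < pos u} \<noteq> {}"
        using True by blast
      then show thesis
        using that by (rule pos_least) auto
    qed
    have "pos u \<le> pos x' \<or> pos x \<le> pos u" if "u \<in> X" for u
      using x'(3)[OF that] x(3)[OF that] ne_y[OF that y(1)] by linarith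
    then have "is_next X x' x"
      using x x' unfolding is_next_def by auto
    moreover have "pos u < pos x" if "u \<in> Y" for u
    proof (rule ccontr)
      assume "\<not> pos u < pos x"
      then have "pos x < pos u"
        using ne_y[OF x(1) that] by simp
      then show False
        using nc x x' y that unfolding crosses_def by blast
    qed
    ultimately show thesis
      using that y y' below by blast
  next
    case False
    then have lt: "pos u \<le> pos x'" if "u \<in> X" for u
      using x'(3)[OF that] ne_y[OF that y(1)] that by (meson linorder_neqE_nat)
    obtain x where x: "x \<in> X" "\<And>u. u \<in> X \<Longrightarrow> pos x \<le> pos u"
      using pos_least x0(1) by blast
    then have "is_next X x' x"
      using x' lt unfolding is_next_def by blast
    then show thesis
      using that y y' below x lt by blast
  qed
qed

text \<open>A line through the two ends of the gap separates the hulls.  If \<open>X\<close> has a single point, the line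
  through the first and the last point of \<open>Y\<close> takes its place, if these differ.\<close>

lemma disjnt_convex_hulls_aux:
  assumes XY: "X \<subseteq> V" "Y \<subseteq> V" "X \<inter> Y = {}" and ne: "Y \<noteq> {}" and nc: "\<not> crosses X Y"
    and x0: "x0 \<in> X" "\<And>u. u \<in> Y \<Longrightarrow> pos x0 < pos u"
  shows "disjnt (convex hull X) (convex hull Y)"
proof -
  obtain x' x y y' where nxt: "is_next X x' x" and y: "y \<in> Y" "y' \<in> Y"
    and ends: "\<forall>u\<in>Y. pos y \<le> pos u \<and> pos u \<le> pos y'"
    and above: "\<forall>u\<in>Y. pos x' < pos u" and x: "pos x \<le> pos x' \<or> (\<forall>u\<in>Y. pos u < pos x)"
    by (rule block_in_gap[OF assms])
  note Y = bspec[OF ends] and x' = bspec[OF above]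
  have V: "x \<in> V" "x' \<in> V" "y \<in> V" "y' \<in> V" and xX: "x \<in> X" "x' \<in> X"
    using nxt y XY unfolding is_next_def by auto
  show ?thesis
  proof (cases "pos x' < pos x")
    case True
    show ?thesis
    proof (rule disjnt_convex_hulls_by_line)
      fix u assume u: "u \<in> X"
      then have "pos u \<le> pos x' \<or> pos x \<le> pos u"
        using nxt True xX unfolding is_next_def by (meson leD)
      then have "u = x' \<or> u = x \<or> pos u < pos x' \<or> pos x < pos u"
        using V subsetD[OF XY(1) u] pos_eq[of u x'] pos_eq[of u x] by (metis le_neq_implies_less)
      then have "orient x' x u \<le> 0"
        using orient_beyond[of x' x u] True V u XY(1) by auto
      then show "0 \<le> orient x x' u"
        using orient_flip[of x x' u] by simp
    next
      fix u assume u: "u \<in> Y"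
      then have "pos x' < pos u" "pos u < pos x"
        using x' x True by auto
      then have "orient x' u x < 0"
        using clockwise V u XY by blast
      then show "orient x x' u < 0"
        by (metis orient_rotate)
    qed
  next
    case False
    then have le: "\<And>u. u \<in> X \<Longrightarrow> pos x \<le> pos u \<and> pos u \<le> pos x'"
      using nxt unfolding is_next_def by blast
    show ?thesis
    proof (cases "pos x < pos x'")
      case True
      show ?thesis
      proof (rule disjnt_convex_hulls_by_line)
        show "0 \<le> orient x x' u" if "u \<in> X" for u
          using orient_between V le that XY by blast
        show "orient x x' u < 0" if "u \<in> Y" for u
          using orient_beyond True V x' that XY by blast
      qed
    next
      case False
      then have "pos u = pos x" if "u \<in> X" for u
        using le[OF that] le[OF xX(2)] by simp
      then have X: "X = {x}"
        using pos_eq V XY(1) xX by blast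
      show ?thesis
      proof (cases "pos y < pos y'")
        case True
        have "disjnt (convex hull Y) (convex hull X)"
        proof (rule disjnt_convex_hulls_by_line)
          show "0 \<le> orient y y' u" if "u \<in> Y" for u
            using orient_between V Y that XY by blast
          show "orient y y' u < 0" if "u \<in> X" for u
            using orient_beyond True V x' that y xX X by blast
        qed
        then show ?thesis
          by (simp add: disjnt_sym)
      next
        case False
        then have "pos u = pos y" if "u \<in> Y" for u
          using Y[OF that] Y[OF y(2)] by simp
        then have "Y = {y}"
          using pos_eq V XY(2) y by blast
        then show ?thesis
          using X XY(3) by (simp add: disjnt_def)
      qed
    qed
  qed
qed

lemma disjnt_convex_hulls_iff:
  assumes XY: "X \<subseteq> V" "Y \<subseteq> V" "X \<inter> Y = {}"
  shows "disjnt (convex hull X) (convex hull Y) \<longleftrightarrow> \<not> crosses X Y \<and> \<not> crosses Y X"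
proof
  assume "disjnt (convex hull X) (convex hull Y)"
  then show "\<not> crosses X Y \<and> \<not> crosses Y X"
    using convex_hulls_meet XY disjnt_sym by blast
next
  assume nc: "\<not> crosses X Y \<and> \<not> crosses Y X"
  show "disjnt (convex hull X) (convex hull Y)"
  proof (cases "X = {} \<or> Y = {}")
    case False
    obtain x where x: "x \<in> X" "\<And>u. u \<in> X \<Longrightarrow> pos x \<le> pos u"
      using pos_least False by blast
    obtain y where y: "y \<in> Y" "\<And>u. u \<in> Y \<Longrightarrow> pos y \<le> pos u"
      using pos_least False by blast
    have "pos x \<noteq> pos y"
      using x y XY pos_eq by blast
    then consider "pos x < pos y" | "pos y < pos x"
      by linarith
    then show ?thesis
    proof cases
      case 1
      then have "pos x < pos u" if "u \<in> Y" for u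
        using y(2)[OF that] by simp
      then show ?thesis
        using disjnt_convex_hulls_aux[OF XY _ _ x(1)] nc y(1) by blast
    next
      case 2
      then have "pos y < pos u" if "u \<in> X" for u
        using x(2)[OF that] by simp
      then have "disjnt (convex hull Y) (convex hull X)"
        using disjnt_convex_hulls_aux[OF XY(2,1) _ _ _ y(1)] XY(3) nc x(1) by blast
      then show ?thesis
        by (simp add: disjnt_sym)
    qed
  qed (auto simp: disjnt_def)
qed

lemma noncrossing_partitions_iff:
  "\<pi> \<in> noncrossing_partitions V \<longleftrightarrow>
     partition_on V \<pi> \<and> (\<forall>A\<in>\<pi>. \<forall>B\<in>\<pi>. A \<noteq> B \<longrightarrow> \<not> crosses A B)"
proof (cases "partition_on V \<pi>")
  case True
  have "disjnt (convex hull A) (convex hull B) \<longleftrightarrow> \<not> crosses A B \<and> \<not> crosses B A"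
    if "A \<in> \<pi>" "B \<in> \<pi>" "A \<noteq> B" for A B
    using disjnt_convex_hulls_iff[of A B] that True disjointD[of \<pi> A B]
    by (auto simp: partition_on_def)
  then show ?thesis
    using True unfolding noncrossing_partitions_def pairwise_def by auto
qed (simp add: noncrossing_partitions_def)

end

section \<open>Covering relations\<close>

definition same_block :: "'a set set \<Rightarrow> 'a \<Rightarrow> 'a \<Rightarrow> bool" where
  "same_block \<pi> u v \<longleftrightarrow> (\<exists>B\<in>\<pi>. u \<in> B \<and> v \<in> B)"

definition merge_blocks :: "'a set set \<Rightarrow> 'a set \<Rightarrow> 'a set \<Rightarrow> 'a set set" where
  "merge_blocks \<pi> X Y = insert (X \<union> Y) (\<pi> - {X, Y})"

lemma partition_block_unique:
  assumes "partition_on V \<pi>" "A \<in> \<pi>" "B \<in> \<pi>" "v \<in> A" "v \<in> B"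
  shows "A = B"
  using assms by (meson disjointD disjoint_iff partition_onD2)

lemma partition_block_exists:
  assumes "partition_on V \<pi>" "v \<in> V"
  obtains B where "B \<in> \<pi>" "v \<in> B"
  using assms by (auto simp: partition_on_def)

lemma partition_block_subset:
  assumes "partition_on V \<pi>" "B \<in> \<pi>"
  shows "B \<subseteq> V"
  using assms by (auto simp: partition_on_def)

lemma same_block_sym: "same_block \<pi> u v \<Longrightarrow> same_block \<pi> v u"
  unfolding same_block_def by blast

lemma same_block_trans:
  "\<lbrakk>partition_on V \<pi>; same_block \<pi> u v; same_block \<pi> v w\<rbrakk> \<Longrightarrow> same_block \<pi> u w"
  unfolding same_block_def by (metis partition_block_unique)

lemma same_block_refines: "\<lbrakk>refines V \<pi> \<pi>'; same_block \<pi> u v\<rbrakk> \<Longrightarrow> same_block \<pi>' u v"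
  unfolding same_block_def refines_def by blast

lemma partition_on_merge_blocks:
  assumes "partition_on V \<pi>" "X \<in> \<pi>" "Y \<in> \<pi>"
  shows "partition_on V (merge_blocks \<pi> X Y)"
proof (rule partition_onI)
  show "{} \<notin> merge_blocks \<pi> X Y"
    using assms by (auto simp: merge_blocks_def partition_on_def)
  show "\<Union> (merge_blocks \<pi> X Y) = V"
    using assms unfolding merge_blocks_def partition_on_def by blast
  show "disjnt A B" if "A \<in> merge_blocks \<pi> X Y" "B \<in> merge_blocks \<pi> X Y" "A \<noteq> B" for A B
  proof -
    have "disjnt C D" if "C \<in> \<pi>" "D \<in> \<pi>" "C \<noteq> D" for C D
      using assms(1) that by (meson disjnt_iff partition_block_unique)
    note d = this
    have "disjnt (X \<union> Y) C" if "C \<in> \<pi> - {X, Y}" for C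
      using that assms(2,3) d[of X C] d[of Y C] by (auto simp: disjnt_Un1)
    then show ?thesis
      using that d disjnt_sym unfolding merge_blocks_def by (metis DiffD1 insertE)
  qed
qed

lemma refines_merge_blocks:
  assumes "partition_on V \<pi>" "X \<in> \<pi>" "Y \<in> \<pi>"
  shows "refines V \<pi> (merge_blocks \<pi> X Y)"
  unfolding refines_def using assms partition_on_merge_blocks[OF assms]
  by (auto simp: merge_blocks_def)

lemma merge_blocks_refines:
  assumes "refines V \<pi> \<pi>'" "X \<in> \<pi>" "Y \<in> \<pi>" "W \<in> \<pi>'" "X \<subseteq> W" "Y \<subseteq> W"
  shows "refines V (merge_blocks \<pi> X Y) \<pi>'"
proof -
  have "partition_on V \<pi>"
    using assms(1) by (simp add: refines_def)
  from partition_on_merge_blocks[OF this assms(2,3)] show ?thesis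
    using assms unfolding refines_def merge_blocks_def by auto
qed

lemma same_block_merge_blocks:
  assumes "same_block (merge_blocks \<pi> X Y) u v"
  shows "same_block \<pi> u v \<or> u \<in> X \<union> Y \<and> v \<in> X \<union> Y"
  using assms unfolding same_block_def merge_blocks_def by auto

context clockwise_polygon
begin

lemma nc_partition_on: "\<pi> \<in> noncrossing_partitions V \<Longrightarrow> partition_on V \<pi>"
  by (simp add: noncrossing_partitions_def)

lemma nc_perm_eq:
  assumes "partition_on V \<pi>" "B \<in> \<pi>" "is_next B u w"
  shows "nc_perm \<pi> u = w"
proof -
  have u: "u \<in> B"
    using assms(3) by (simp add: is_next_def)
  have "(THE B. B \<in> \<pi> \<and> u \<in> B) = B"
    using assms u by (intro the_equality) (auto dest: partition_block_unique)
  moreover have "clockwise_next B u = w"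
    using assms by (intro clockwise_next_eq) (auto simp: partition_on_def)
  ultimately show ?thesis
    using u assms(2) unfolding nc_perm_def by auto
qed

lemma nc_perm_outside:
  assumes "partition_on V \<pi>" "u \<notin> V"
  shows "nc_perm \<pi> u = u"
  using assms by (simp add: nc_perm_def partition_on_def)

lemma nc_perm_next:
  assumes "partition_on V \<pi>" "B \<in> \<pi>" "u \<in> B"
  shows "is_next B u (nc_perm \<pi> u)"
proof -
  obtain w where "is_next B u w"
    using is_next_exists[OF assms(3) partition_block_subset[OF assms(1,2)]] by blast
  then show ?thesis
    using nc_perm_eq assms by simp
qed

lemma nc_perm_permutes:
  assumes \<pi>: "partition_on V \<pi>"
  shows "nc_perm \<pi> permutes V"
proof (rule bij_imp_permutes)
  have in_block: "nc_perm \<pi> u \<in> B" if "B \<in> \<pi>" "u \<in> B" for u B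
    using nc_perm_next[OF \<pi> that] by (simp add: is_next_def)
  have "inj_on (nc_perm \<pi>) V"
  proof (rule inj_onI)
    fix u v assume uv: "u \<in> V" "v \<in> V" "nc_perm \<pi> u = nc_perm \<pi> v"
    obtain A B where A: "A \<in> \<pi>" "u \<in> A" and B: "B \<in> \<pi>" "v \<in> B"
      using partition_block_exists[OF \<pi>] uv by metis
    then have "A = B"
      using partition_block_unique[OF \<pi> A(1) B(1)] in_block[OF A] in_block[OF B] uv(3) by simp
    then show "u = v"
      using is_next_injective[OF partition_block_subset[OF \<pi> A(1)]]
        nc_perm_next[OF \<pi> A] nc_perm_next[OF \<pi> B] uv(3) by metis
  qed
  moreover have "nc_perm \<pi> ` V \<subseteq> V"
    using in_block partition_block_exists[OF \<pi>] partition_block_subset[OF \<pi>] by blast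
  ultimately show "bij_betw (nc_perm \<pi>) V V"
    using finite_V by (simp add: bij_betw_def endo_inj_surj)
qed (rule nc_perm_outside[OF \<pi>])

text \<open>The two possible positions of the gap of \<open>X\<close> that contains \<open>Y\<close>: inside the list, or around
  its ends.\<close>

lemma gap_cases:
  assumes "is_next X x' x" and "pos x \<le> pos x' \<or> (\<forall>u\<in>Y. pos u < pos x)"
  obtains (inner) "pos x' < pos x" "\<And>u. u \<in> X \<Longrightarrow> pos u \<le> pos x' \<or> pos x \<le> pos u"
      "\<And>u. u \<in> Y \<Longrightarrow> pos u < pos x"
    | (outer) "\<And>u. u \<in> X \<Longrightarrow> pos x \<le> pos u \<and> pos u \<le> pos x'"
proof (cases "pos x' < pos x")
  case True
  have "x' \<in> X"
    using assms(1) by (simp add: is_next_def)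
  then have "\<forall>u\<in>X. pos u \<le> pos x' \<or> pos x \<le> pos u"
    using assms(1) True unfolding is_next_def by auto
  then show thesis
    using inner True assms(2) by auto
next
  case False
  then show thesis
    using outer assms(1) unfolding is_next_def by auto
qed

text \<open>Merging \<open>X\<close> with a set \<open>Y\<close> in the gap from \<open>x'\<close> to \<open>x\<close> redirects only two successors: \<open>x'\<close> now leads
  to the first point of \<open>Y\<close> and the last point of \<open>Y\<close> leads to \<open>x\<close>.\<close>

lemma is_next_union:
  assumes XY: "X \<subseteq> V" "Y \<subseteq> V"
    and x: "is_next X x' x" and y: "y \<in> Y" "y' \<in> Y"
    and Y: "\<forall>u\<in>Y. pos y \<le> pos u \<and> pos u \<le> pos y'" and x': "\<forall>u\<in>Y. pos x' < pos u"
    and gap: "pos x \<le> pos x' \<or> (\<forall>u\<in>Y. pos u < pos x)"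
  shows "is_next (X \<union> Y) x' y" and "is_next (X \<union> Y) y' x"
    and "\<lbrakk>is_next X u w; u \<noteq> x'\<rbrakk> \<Longrightarrow> is_next (X \<union> Y) u w"
    and "\<lbrakk>is_next Y u w; u \<noteq> y'\<rbrakk> \<Longrightarrow> is_next (X \<union> Y) u w"
proof -
  have xX: "x \<in> X" "x' \<in> X"
    using x by (auto simp: is_next_def)
  have *: "is_next (X \<union> Y) x' y \<and> is_next (X \<union> Y) y' x"
    using x gap
  proof (cases rule: gap_cases)
    case inner
    have "pos u \<le> pos x' \<or> pos y \<le> pos u" "pos u \<le> pos y' \<or> pos x \<le> pos u" if "u \<in> X \<union> Y" for u
      using that inner(2)[of u] inner(3)[OF y(1)] Y x' y(2) by force+
    then show ?thesis
      using xX y x' inner(3)[OF y(2)] unfolding is_next_def by blast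
  next
    case outer
    have "pos u \<le> pos x' \<or> pos y \<le> pos u" "pos x \<le> pos u \<and> pos u \<le> pos y'" if "u \<in> X \<union> Y" for u
      using that outer[of u] outer[OF xX(2)] Y x' y(2) by force+
    then show ?thesis
      using xX y x' unfolding is_next_def by blast
  qed
  then show "is_next (X \<union> Y) x' y" "is_next (X \<union> Y) y' x"
    by auto
  show "is_next (X \<union> Y) u w" if u: "is_next X u w" "u \<noteq> x'"
  proof -
    have mem: "u \<in> X" "w \<in> X"
      using u by (auto simp: is_next_def)
    have ne: "pos u \<noteq> pos x'"
      using u(2) pos_eq[of u x'] mem xX XY(1) by auto
    have "pos t \<le> pos u \<or> pos w \<le> pos t"
      if t: "t \<in> Y" and uw: "\<forall>t\<in>X. pos t \<le> pos u \<or> pos w \<le> pos t" for t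
    proof -
      have 1: "pos x' \<le> pos u \<or> pos w \<le> pos x'" and 2: "pos x' < pos t"
        using uw xX x' t by auto
      from x gap show ?thesis
      proof (cases rule: gap_cases)
        case inner
        then show ?thesis
          using 1 2 ne inner(2)[OF mem(1)] inner(3)[OF t] by linarith
      next
        case outer
        then show ?thesis
          using 1 2 ne outer[OF mem(1)] by linarith
      qed
    qed
    moreover have "pos w \<le> pos t \<and> pos t \<le> pos u"
      if t: "t \<in> Y" and all: "\<forall>t\<in>X. pos w \<le> pos t \<and> pos t \<le> pos u" for t
    proof -
      have 1: "pos w \<le> pos x'" "pos x' \<le> pos u" "pos x \<le> pos u" and 2: "pos x' < pos t"
        using all xX x' t by auto
      from x gap show ?thesis
      proof (cases rule: gap_cases)
        case inner
        then show ?thesis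
          using 1 2 inner(3)[OF t] by linarith
      next
        case outer
        then show ?thesis
          using 1 2 ne outer[OF mem(1)] by linarith
      qed
    qed
    ultimately show ?thesis
      using u(1) unfolding is_next_def by blast
  qed
  show "is_next (X \<union> Y) u w" if u: "is_next Y u w" "u \<noteq> y'"
  proof -
    have mem: "u \<in> Y" "w \<in> Y"
      using u by (auto simp: is_next_def)
    have "pos u < pos y'"
      using u(2) pos_eq[of u y'] mem y XY(2) Y le_neq_implies_less by blast
    then have lt: "pos u < pos w" "\<forall>t\<in>Y. pos t \<le> pos u \<or> pos w \<le> pos t"
      using u(1) y(2) unfolding is_next_def by auto
    have "pos t \<le> pos u \<or> pos w \<le> pos t" if t: "t \<in> X" for t
      using x gap
    proof (cases rule: gap_cases)
      case inner
      then show ?thesis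
        using inner(2)[OF t] inner(3)[OF mem(2)] bspec[OF x' mem(1)] by linarith
    next
      case outer
      then show ?thesis
        using outer[OF t] bspec[OF x' mem(1)] by linarith
    qed
    then show ?thesis
      using lt mem unfolding is_next_def by blast
  qed
qed

lemma crosses_edge:
  assumes "pos u < pos v"
  shows "crosses {u, v} Z \<Longrightarrow> \<exists>q\<in>Z. \<exists>s\<in>Z. pos u < pos q \<and> pos q < pos v \<and> pos v < pos s"
    and "crosses Z {u, v} \<Longrightarrow> \<exists>p\<in>Z. \<exists>r\<in>Z. pos p < pos u \<and> pos u < pos r \<and> pos r < pos v"
  using assms unfolding crosses_def by (auto dest: order.strict_trans)

text \<open>The permutations before and after the merge differ only at the two redirected points, so their
  quotient exchanges the targets \<open>x\<close> and \<open>y\<close>.  The edge between \<open>x\<close> and \<open>y\<close> separates the other points of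
  \<open>X\<close> from the other points of \<open>Y\<close>, so it crosses no chord of either block.\<close>

lemma cover_edge_merge:
  assumes \<pi>: "\<pi> \<in> noncrossing_partitions V" and X: "X \<in> \<pi>" and Y: "Y \<in> \<pi>" and ne: "X \<noteq> Y"
    and x0: "x0 \<in> X" "\<And>u. u \<in> Y \<Longrightarrow> pos x0 < pos u"
  obtains x y where "x \<in> X" "y \<in> Y" "\<forall>u\<in>Y. pos y \<le> pos u"
    "(\<forall>u\<in>X. pos x \<le> pos u) \<or> pos y < pos x"
    "cover_edge \<pi> (merge_blocks \<pi> X Y) = {x, y}"
    "edge_transposition {x, y} \<circ> nc_perm \<pi> = nc_perm (merge_blocks \<pi> X Y)"
    "\<forall>Z\<in>{X, Y}. \<not> crosses {x, y} Z \<and> \<not> crosses Z {x, y}"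
proof -
  let ?\<pi>' = "merge_blocks \<pi> X Y"
  let ?f = "nc_perm \<pi>" and ?f' = "nc_perm ?\<pi>'"
  have part: "partition_on V \<pi>"
    using \<pi> by (rule nc_partition_on)
  have part': "partition_on V ?\<pi>'"
    using part X Y by (rule partition_on_merge_blocks)
  have XV: "X \<subseteq> V" and YV: "Y \<subseteq> V"
    using part X Y partition_block_subset by blast+
  have disj: "X \<inter> Y = {}"
    using partition_block_unique[OF part X Y] ne by auto
  have "Y \<noteq> {}"
    using part Y by (auto simp: partition_on_def)
  moreover have "\<not> crosses X Y"
    using \<pi> X Y ne noncrossing_partitions_iff by blast
  ultimately obtain x' x y y' where g: "is_next X x' x" "y \<in> Y" "y' \<in> Y"
      "\<forall>u\<in>Y. pos y \<le> pos u \<and> pos u \<le> pos y'" "\<forall>u\<in>Y. pos x' < pos u"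
      "pos x \<le> pos x' \<or> (\<forall>u\<in>Y. pos u < pos x)"
    by (rule block_in_gap[OF XV YV disj _ _ x0])
  note next_union = is_next_union[OF XV YV g]
  have xX: "x \<in> X" "x' \<in> X"
    using g(1) by (auto simp: is_next_def)
  have merged: "X \<union> Y \<in> ?\<pi>'"
    by (simp add: merge_blocks_def)
  have "is_next Y y' y"
    using g unfolding is_next_def by blast
  then have f: "?f x' = x" "?f y' = y"
    using nc_perm_eq[OF part X g(1)] nc_perm_eq[OF part Y] by simp_all
  have f': "?f' x' = y" "?f' y' = x"
    using nc_perm_eq[OF part' merged] next_union by simp_all
  have same: "?f' u = ?f u" if "u \<noteq> x'" "u \<noteq> y'" for u
  proof (cases "u \<in> V")
    case True
    then obtain B where B: "B \<in> \<pi>" "u \<in> B"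
      using part partition_block_exists by metis
    note n = nc_perm_next[OF part B]
    consider "B = X" | "B = Y" | "B \<in> ?\<pi>'"
      using B by (auto simp: merge_blocks_def)
    then show ?thesis
    proof cases
      case 1
      then show ?thesis
        using next_union(3)[of u] n that nc_perm_eq[OF part' merged] by simp
    next
      case 2
      then show ?thesis
        using next_union(4)[of u] n that nc_perm_eq[OF part' merged] by simp
    next
      case 3
      then show ?thesis
        using nc_perm_eq[OF part'] n by simp
    qed
  next
    case False
    then show ?thesis
      using nc_perm_outside part part' by simp
  qed
  have xy: "x \<noteq> y"
    using xX g disj by blast
  have perm: "?f permutes V"
    using part by (rule nc_perm_permutes)
  have "?f' (inv ?f v) \<noteq> v \<longleftrightarrow> v \<in> {x, y}" for v
  proof -
    have v: "?f (inv ?f v) = v"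
      using perm by (rule permutes_inverses)
    have inv: "inv ?f x = x'" "inv ?f y = y'"
      using f permutes_inverses(2)[OF perm] by metis+
    consider "v = x" | "v = y" | "v \<notin> {x, y}"
      by blast
    then show ?thesis
    proof cases
      case 3
      then have "inv ?f v \<noteq> x'" "inv ?f v \<noteq> y'"
        using v f by auto
      then show ?thesis
        using same[of "inv ?f v"] v 3 by simp
    qed (use inv f' xy in auto)
  qed
  then have edge: "cover_edge \<pi> ?\<pi>' = {x, y}"
    unfolding cover_edge_def by auto
  have trans: "edge_transposition {x, y} \<circ> ?f = ?f'"
  proof
    fix u
    have "?f u \<noteq> x" "?f u \<noteq> y" if "u \<noteq> x'" "u \<noteq> y'"
      using that f permutes_inj[OF perm] by (metis injD)+
    then show "(edge_transposition {x, y} \<circ> ?f) u = ?f' u"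
      using f f' same[of u] xy by (cases "u = x'"; cases "u = y'")
        (auto simp: edge_transposition_eq_transpose Transposition.transpose_def)
  qed
  have below_y: "pos y \<le> pos u" "pos x' < pos u" if "u \<in> Y" for u
    using that g(4,5) by auto
  have result: "((\<forall>u\<in>X. pos x \<le> pos u) \<or> pos y < pos x) \<and>
      (\<forall>Z\<in>{X, Y}. \<not> crosses {x, y} Z \<and> \<not> crosses Z {x, y})"
    using g(1,6)
  proof (cases rule: gap_cases)
    case inner
    have yx: "pos y < pos x"
      using inner(3)[OF g(2)] .
    have X_out: "pos u < pos y \<or> pos x \<le> pos u" if "u \<in> X" for u
      using inner(2)[OF that] below_y(2)[OF g(2)] by linarith
    have "\<not> crosses {y, x} X \<and> \<not> crosses X {y, x}"
      using crosses_edge[OF yx, of X] X_out by (meson leD less_asym)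
    moreover have "\<not> crosses {y, x} Y \<and> \<not> crosses Y {y, x}"
      using crosses_edge[OF yx, of Y] inner(3) below_y(1) by (meson leD less_asym)
    ultimately show ?thesis
      using yx by (simp add: insert_commute)
  next
    case outer
    have lt: "pos u < pos y" if "u \<in> X" for u
      using outer[OF that] below_y(2)[OF g(2)] by linarith
    note xy_lt = lt[OF xX(1)]
    have "\<not> crosses {x, y} X \<and> \<not> crosses X {x, y}"
      using crosses_edge[OF xy_lt, of X] outer lt by (meson leD less_asym)
    moreover have "\<not> crosses {x, y} Y \<and> \<not> crosses Y {x, y}"
      using crosses_edge[OF xy_lt, of Y] below_y(1) xy_lt by (meson leD less_asym less_trans)
    ultimately show ?thesis
      using outer by simp
  qed
  show thesis
  proof (rule that)
    show "\<forall>u\<in>Y. pos y \<le> pos u"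
      using g(4) by blast
  qed (use xX(1) g(2) edge trans result in blast)+
qed

text \<open>Let \<open>W\<close> be a block of the larger partition that splits, \<open>X\<close> the part of its first point, \<open>y\<close> the
  first point of \<open>W\<close> outside \<open>X\<close>, and \<open>Y\<close> the part of \<open>y\<close>.  Every other part of \<open>W\<close> lies entirely
  after points of both \<open>X\<close> and \<open>Y\<close>, so it would already cross \<open>X\<close> or \<open>Y\<close> if it crossed the union.
  Hence merging \<open>X\<close> and \<open>Y\<close> gives a noncrossing partition, which a covering relation forces to be
  the larger one.\<close>

lemma cover_is_merge:
  assumes \<pi>: "\<pi> \<in> noncrossing_partitions V" and \<pi>': "\<pi>' \<in> noncrossing_partitions V"
    and le: "refines V \<pi> \<pi>'" and ne: "\<pi> \<noteq> \<pi>'"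
    and cover: "\<And>\<rho>. \<lbrakk>\<rho> \<in> noncrossing_partitions V; refines V \<pi> \<rho>; refines V \<rho> \<pi>'\<rbrakk> \<Longrightarrow> \<rho> = \<pi> \<or> \<rho> = \<pi>'"
  obtains X Y x0 where "X \<in> \<pi>" "Y \<in> \<pi>" "X \<noteq> Y" "\<pi>' = merge_blocks \<pi> X Y"
    "x0 \<in> X" "\<And>u. u \<in> Y \<Longrightarrow> pos x0 < pos u"
proof -
  have part: "partition_on V \<pi>" and part': "partition_on V \<pi>'"
    using \<pi> \<pi>' nc_partition_on by blast+
  have "\<not> \<pi>' \<subseteq> \<pi>"
  proof
    assume "\<pi>' \<subseteq> \<pi>"
    then have "refines V \<pi>' \<pi>"
      using part part' unfolding refines_def by blast
    then show False
      using ne le refines_asym by blast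
  qed
  then obtain W where W: "W \<in> \<pi>'" "W \<notin> \<pi>"
    by blast
  have WV: "W \<subseteq> V"
    using part' W(1) by (rule partition_block_subset)
  have inside: "B \<subseteq> W" if "B \<in> \<pi>" "v \<in> B" "v \<in> W" for B v
    using le that W(1) partition_block_unique[OF part'] unfolding refines_def by (metis subsetD)
  have "W \<noteq> {}"
    using part' W by (auto simp: partition_on_def)
  then obtain x0 where x0: "x0 \<in> W" "\<And>u. u \<in> W \<Longrightarrow> pos x0 \<le> pos u"
    using pos_least by blast
  obtain X where X: "X \<in> \<pi>" "x0 \<in> X"
    using partition_block_exists[OF part, of x0] x0(1) WV by blast
  have XW: "X \<subseteq> W"
    using inside[OF X x0(1)] .
  then have "W - X \<noteq> {}"
    using X(1) W(2) by auto
  then obtain y where y: "y \<in> W - X" "\<And>u. u \<in> W - X \<Longrightarrow> pos y \<le> pos u"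
    by (rule pos_least) (rule that, assumption, blast)
  obtain Y where Y: "Y \<in> \<pi>" "y \<in> Y"
    using partition_block_exists[OF part, of y] y(1) WV by blast
  have YW: "Y \<subseteq> W"
    using inside[OF Y] y(1) by simp
  have XY: "X \<noteq> Y"
    using Y(2) y(1) by auto
  have disj: "Z \<inter> X = {}" if "Z \<in> \<pi>" "Z \<noteq> X" for Z
    using partition_block_unique[OF part that(1) X(1)] that(2) by auto
  have y_le: "pos y \<le> pos u" if "u \<in> W" "u \<notin> X" for u
    using y(2)[of u] that by simp
  have "pos x0 \<noteq> pos y"
    using x0(1) y(1) X(2) WV pos_eq[of x0 y] by auto
  then have x0_y: "pos x0 < pos y"
    using x0(2)[of y] y by simp
  have x0_Y: "pos x0 < pos u" if "u \<in> Y" for u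
  proof -
    have "u \<in> W" "u \<notin> X"
      using that YW disj[OF Y(1)] XY by auto
    then show ?thesis
      using y_le[of u] x0_y by simp
  qed
  let ?\<rho> = "merge_blocks \<pi> X Y"
  have free: "\<not> crosses (X \<union> Y) Z \<and> \<not> crosses Z (X \<union> Y)" if Z: "Z \<in> \<pi>" "Z \<noteq> X" "Z \<noteq> Y" for Z
  proof (cases "Z \<subseteq> W")
    case True
    have lt: "pos x0 < pos z" "pos y < pos z" if "z \<in> Z" for z
    proof -
      have z: "z \<in> W" "z \<notin> X" "z \<noteq> y"
        using that True disj[OF Z(1,2)] partition_block_unique[OF part Z(1) Y(1)] Z(3) Y(2) by auto
      then have "pos z \<noteq> pos y"
        using pos_eq[of z y] WV y(1) by auto
      then show "pos y < pos z"
        using y_le[OF z(1,2)] by simp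
      then show "pos x0 < pos z"
        using x0_y by simp
    qed
    have nc: "\<not> crosses X Z" "\<not> crosses Y Z"
      using \<pi> X Y Z noncrossing_partitions_iff by blast+
    have "\<not> crosses (X \<union> Y) Z"
    proof
      assume "crosses (X \<union> Y) Z"
      then obtain q r s where "q \<in> Z" "r \<in> X \<union> Y" "s \<in> Z" "pos q < pos r" "pos r < pos s"
        unfolding crosses_def by blast
      then show False
        using nc lt X(2) Y(2) unfolding crosses_def by blast
    qed
    moreover have "\<not> crosses Z (X \<union> Y)"
    proof
      assume "crosses Z (X \<union> Y)"
      then obtain p q r where "p \<in> Z" "q \<in> X \<union> Y" "r \<in> Z" "pos p < pos q" "pos q < pos r"
        unfolding crosses_def by blast
      then show False
        using nc lt X(2) Y(2) unfolding crosses_def by blast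
    qed
    ultimately show ?thesis
      by blast
  next
    case False
    obtain W' where W': "W' \<in> \<pi>'" "Z \<subseteq> W'"
      using le Z unfolding refines_def by blast
    then have "W' \<noteq> W"
      using False by blast
    then have "\<not> crosses W W'" "\<not> crosses W' W"
      using \<pi>' W W' noncrossing_partitions_iff by blast+
    then show ?thesis
      using crosses_mono[of _ _ W W'] crosses_mono[of _ _ W' W] W' XW YW by blast
  qed
  have "?\<rho> \<in> noncrossing_partitions V"
    unfolding noncrossing_partitions_iff
  proof (intro conjI ballI impI)
    show "partition_on V ?\<rho>"
      using part X(1) Y(1) by (rule partition_on_merge_blocks)
    show "\<not> crosses A B" if "A \<in> ?\<rho>" "B \<in> ?\<rho>" "A \<noteq> B" for A B
      using that free \<pi> unfolding merge_blocks_def noncrossing_partitions_iff by auto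
  qed
  moreover have "refines V \<pi> ?\<rho>"
    using part X(1) Y(1) by (rule refines_merge_blocks)
  moreover have "refines V ?\<rho> \<pi>'"
    using le X(1) Y(1) W(1) XW YW by (rule merge_blocks_refines)
  moreover have "?\<rho> \<noteq> \<pi>"
  proof
    assume "?\<rho> = \<pi>"
    then have "X \<union> Y \<in> \<pi>"
      by (auto simp: merge_blocks_def)
    then have "X \<union> Y = X" "X \<union> Y = Y"
      using partition_block_unique[OF part] X Y by blast+
    then show False
      using XY by blast
  qed
  ultimately have "\<pi>' = ?\<rho>"
    using cover by blast
  then show thesis
    using that X Y XY x0_Y by blast
qed

end

section \<open>The label of a saturated chain\<close>

lemma edge_product_snoc: "edge_product (ts @ [d]) = edge_transposition d \<circ> edge_product ts"
  by (simp add: edge_product_def)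

text \<open>In every step the two merged blocks are named so that \<open>X\<close> is the one that starts first.\<close>

locale saturated_chain = clockwise_polygon +
  fixes ps :: "complex set set list"
  assumes V_nonempty: "V \<noteq> {}"
    and ps_nonempty: "ps \<noteq> []"
    and noncrossing: "i < length ps \<Longrightarrow> ps ! i \<in> noncrossing_partitions V"
    and first: "ps ! 0 = nc_bot V"
    and last: "ps ! (length ps - 1) = nc_top V"
    and merge: "Suc i < length ps \<Longrightarrow> \<exists>X\<in>ps ! i. \<exists>Y\<in>ps ! i. X \<noteq> Y \<and>
      ps ! Suc i = merge_blocks (ps ! i) X Y \<and> (\<exists>x0\<in>X. \<forall>u\<in>Y. pos x0 < pos u)"
begin

definition edge :: "nat \<Rightarrow> complex set" where
  "edge i = cover_edge (ps ! i) (ps ! Suc i)"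

definition label :: "complex set list" where
  "label = map edge [0..<length ps - 1]"

lemma label_eq: "map2 cover_edge (butlast ps) (tl ps) = label"
  by (rule nth_equalityI) (auto simp: label_def edge_def nth_butlast nth_tl)

lemma set_label: "set label = edge ` {..<length ps - 1}"
  by (auto simp: label_def atLeast0LessThan)

lemma in_set_label: "d \<in> set label \<longleftrightarrow> (\<exists>i. Suc i < length ps \<and> d = edge i)"
  by (auto simp: set_label less_diff_conv)

lemma part: "i < length ps \<Longrightarrow> partition_on V (ps ! i)"
  using noncrossing nc_partition_on by blast

lemma edge_obtain:
  assumes "Suc i < length ps"
  obtains X Y x y x0 where "X \<in> ps ! i" "Y \<in> ps ! i" "X \<noteq> Y" "ps ! Suc i = merge_blocks (ps ! i) X Y"
    "x0 \<in> X" "\<forall>u\<in>Y. pos x0 < pos u"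
    "x \<in> X" "y \<in> Y" "\<forall>u\<in>Y. pos y \<le> pos u" "(\<forall>u\<in>X. pos x \<le> pos u) \<or> pos y < pos x"
    "edge i = {x, y}" "edge_transposition {x, y} \<circ> nc_perm (ps ! i) = nc_perm (ps ! Suc i)"
    "\<forall>Z\<in>{X, Y}. \<not> crosses {x, y} Z \<and> \<not> crosses Z {x, y}"
proof -
  obtain X Y x0 where m: "X \<in> ps ! i" "Y \<in> ps ! i" "X \<noteq> Y" "ps ! Suc i = merge_blocks (ps ! i) X Y"
      "x0 \<in> X" and lt: "\<forall>u\<in>Y. pos x0 < pos u"
    using merge[OF assms] by blast
  have "ps ! i \<in> noncrossing_partitions V"
    using noncrossing assms by simp
  then obtain x y where "x \<in> X" "y \<in> Y" "\<forall>u\<in>Y. pos y \<le> pos u"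
    "(\<forall>u\<in>X. pos x \<le> pos u) \<or> pos y < pos x"
    "cover_edge (ps ! i) (merge_blocks (ps ! i) X Y) = {x, y}"
    "edge_transposition {x, y} \<circ> nc_perm (ps ! i) = nc_perm (merge_blocks (ps ! i) X Y)"
    "\<forall>Z\<in>{X, Y}. \<not> crosses {x, y} Z \<and> \<not> crosses Z {x, y}"
    by (rule cover_edge_merge[OF _ m(1-3,5) bspec[OF lt]])
  then show thesis
    using that m lt unfolding edge_def by simp
qed

lemma refines_step: "Suc i < length ps \<Longrightarrow> refines V (ps ! i) (ps ! Suc i)"
  using merge[of i] refines_merge_blocks[OF part[of i]] by auto

lemma refines_mono:
  assumes "i \<le> j" "j < length ps"
  shows "refines V (ps ! i) (ps ! j)"
  using assms
proof (induction j rule: dec_induct)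
  case base
  then show ?case
    using part refines_refl by blast
next
  case (step j)
  then show ?case
    using refines_step[of j] refines_trans by (metis Suc_lessD)
qed

lemma edge_ends:
  assumes "Suc i < length ps"
  obtains x y where "edge i = {x, y}" "x \<noteq> y" "x \<in> V" "y \<in> V"
    "\<not> same_block (ps ! i) x y" "same_block (ps ! Suc i) x y"
proof -
  obtain X Y x y where m: "X \<in> ps ! i" "Y \<in> ps ! i" "X \<noteq> Y" "ps ! Suc i = merge_blocks (ps ! i) X Y"
    "x \<in> X" "y \<in> Y" "edge i = {x, y}"
    using edge_obtain[OF assms] by metis
  note p = part[OF Suc_lessD[OF assms]]
  have "\<not> same_block (ps ! i) x y"
    using m partition_block_unique[OF p] unfolding same_block_def by metis
  moreover have "same_block (ps ! Suc i) x y"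
    using m unfolding same_block_def merge_blocks_def by blast
  moreover have "x \<in> V" "y \<in> V"
    using partition_block_subset[OF p] m by blast+
  moreover have "x \<noteq> y"
    using m partition_block_unique[OF p] by metis
  ultimately show thesis
    using that m(7) by blast
qed

text \<open>With \<open>edge_not_in_block\<close> this separates the edges of the steps before \<open>j\<close> from the edge of step \<open>j\<close>,
  which yields that the edges are distinct, acyclic and noncrossing.\<close>

lemma edge_in_block:
  assumes "i < j" "j < length ps"
  obtains Z where "Z \<in> ps ! j" "edge i \<subseteq> Z"
proof -
  have i: "Suc i < length ps"
    using assms by simp
  obtain x y where e: "edge i = {x, y}" "same_block (ps ! Suc i) x y"
    using edge_ends[OF i] by metis
  have "refines V (ps ! Suc i) (ps ! j)"
    using assms by (intro refines_mono) auto
  then have "same_block (ps ! j) x y"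
    using e same_block_refines by metis
  then obtain Z where "Z \<in> ps ! j" "x \<in> Z" "y \<in> Z"
    unfolding same_block_def by blast
  then show thesis
    using that[of Z] e(1) by simp
qed

lemma edge_not_in_block:
  assumes "Suc i < length ps" "Z \<in> ps ! i"
  shows "\<not> edge i \<subseteq> Z"
  using edge_ends[OF assms(1)] assms(2) unfolding same_block_def by (metis insert_subset)

lemma edge_inj:
  assumes "i < j" "Suc j < length ps"
  shows "edge i \<noteq> edge j"
  using edge_in_block[of i j] edge_not_in_block[of j] assms by (metis Suc_lessD)

lemma distinct_label: "distinct label"
proof -
  have "inj_on edge {0..<length ps - 1}"
  proof (rule linorder_inj_onI')
    show "edge i \<noteq> edge j" if "i \<in> {0..<length ps - 1}" "j \<in> {0..<length ps - 1}" "i < j" for i j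
      using that edge_inj[of i j] by simp
  qed
  then show ?thesis
    by (simp add: label_def distinct_map)
qed

lemma edge_product_prefix:
  assumes "i < length ps"
  shows "edge_product (map edge [0..<i]) = nc_perm (ps ! i)"
  using assms
proof (induction i)
  case 0
  have "nc_perm (nc_bot V) v = v" for v
  proof (cases "v \<in> V")
    case True
    have "partition_on V (nc_bot V)"
      using nc_bot_least(1) nc_partition_on by blast
    moreover have "{v} \<in> nc_bot V"
      using True by (simp add: nc_bot_def)
    moreover have "is_next {v} v v"
      by (simp add: is_next_def)
    ultimately show ?thesis
      by (rule nc_perm_eq)
  next
    case False
    then show ?thesis
      by (simp add: nc_perm_def nc_bot_def)
  qed
  then show ?case
    by (simp add: first edge_product_def fun_eq_iff)
next
  case (Suc i)
  obtain x y where "edge i = {x, y}" "edge_transposition {x, y} \<circ> nc_perm (ps ! i) = nc_perm (ps ! Suc i)"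
    using edge_obtain[OF Suc.prems] by metis
  then show ?case
    using Suc by (simp add: edge_product_snoc)
qed

lemma connected_prefix:
  assumes "i < length ps" "same_block (ps ! i) u v"
  shows "(u, v) \<in> {(x, y). {x, y} \<in> edge ` {..<i}}\<^sup>*"
  using assms
proof (induction i arbitrary: u v)
  case 0
  then show ?case
    by (auto simp: first same_block_def nc_bot_def)
next
  case (Suc i)
  let ?R = "\<lambda>i. {(x, y). {x, y} \<in> edge ` {..<i}}"
  have sub: "(?R i)\<^sup>* \<subseteq> (?R (Suc i))\<^sup>*"
    by (intro rtrancl_mono) auto
  have IH: "(u, v) \<in> (?R (Suc i))\<^sup>*" if "same_block (ps ! i) u v" for u v
    using Suc.IH[of u v] Suc.prems(1) that sub by auto
  have sym: "sym ((?R (Suc i))\<^sup>*)"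
    by (intro sym_rtrancl symI) (auto simp: insert_commute)
  obtain X Y x y where m: "X \<in> ps ! i" "Y \<in> ps ! i" "ps ! Suc i = merge_blocks (ps ! i) X Y"
    "x \<in> X" "y \<in> Y" "edge i = {x, y}"
    using edge_obtain[OF Suc.prems(1)] by metis
  have xy: "(x, y) \<in> (?R (Suc i))\<^sup>*"
    using m(6) by (intro r_into_rtrancl) auto
  have to_x: "(w, x) \<in> (?R (Suc i))\<^sup>*" if "w \<in> X \<union> Y" for w
  proof (cases "w \<in> X")
    case True
    then show ?thesis
      using IH[of w x] m unfolding same_block_def by blast
  next
    case False
    then have "(w, y) \<in> (?R (Suc i))\<^sup>*"
      using IH[of w y] m that unfolding same_block_def by blast
    then show ?thesis
      using symD[OF sym xy] by (rule rtrancl_trans)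
  qed
  have "same_block (ps ! i) u v \<or> u \<in> X \<union> Y \<and> v \<in> X \<union> Y"
    using Suc.prems(2) unfolding m(3) by (rule same_block_merge_blocks)
  then show ?case
  proof
    assume uv: "u \<in> X \<union> Y \<and> v \<in> X \<union> Y"
    then have u: "u \<in> X \<union> Y" and v: "v \<in> X \<union> Y"
      by simp_all
    show ?thesis
      by (rule rtrancl_trans[OF to_x[OF u] symD[OF sym to_x[OF v]]])
  qed (rule IH)
qed

text \<open>Going around the cycle the other way relates the two ends of the step \<open>k\<close>.\<close>

lemma cycle_closes:
  fixes vs :: "'b list"
  assumes k: "k < length vs"
    and trans: "\<And>x y z. r x y \<Longrightarrow> r y z \<Longrightarrow> r x z"
    and sym: "\<And>x y. r x y \<Longrightarrow> r y x"
    and step: "\<And>j. \<lbrakk>j < length vs; j \<noteq> k\<rbrakk> \<Longrightarrow> r (vs ! j) (vs ! (Suc j mod length vs))"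
    and len: "2 \<le> length vs"
  shows "r (vs ! k) (vs ! (Suc k mod length vs))"
proof -
  let ?n = "length vs"
  have "r (vs ! (Suc k mod ?n)) (vs ! ((k + Suc j) mod ?n))" if "1 \<le> j" "j < ?n" for j
    using that
  proof (induction j rule: nat_induct_at_least)
    case base
    have "Suc k mod ?n < ?n" "Suc k mod ?n \<noteq> k"
      using k len by (auto simp: mod_Suc)
    from step[OF this] show ?case
      by (simp add: mod_Suc_eq)
  next
    case (Suc j)
    have "(k + Suc j) mod ?n = (if k + Suc j < ?n then k + Suc j else k + Suc j - ?n)"
      using k Suc.prems by (simp add: le_mod_geq not_less)
    then have ne: "(k + Suc j) mod ?n \<noteq> k"
      using k Suc.prems by (auto split: if_splits)
    have "(k + Suc j) mod ?n < ?n"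
      using k by (intro mod_less_divisor) auto
    from step[OF this ne] show ?case
      using Suc trans by (simp add: mod_Suc_eq)
  qed
  note around = this
  obtain m where m: "?n = Suc m"
    using k by (cases ?n) auto
  then have "1 \<le> m" "m < ?n"
    using len by auto
  then have "r (vs ! (Suc k mod ?n)) (vs ! ((k + Suc m) mod ?n))"
    by (rule around)
  then have "r (vs ! (Suc k mod ?n)) (vs ! k)"
    using k unfolding m[symmetric] by simp
  then show ?thesis
    by (rule sym)
qed

text \<open>In a cycle that uses the last edge, the other edges lie inside blocks of the preceding partition and
  connect the two ends of the last edge, which this partition separates.\<close>

lemma acyclic_prefix:
  assumes "i < length ps" "3 \<le> length vs" "distinct vs"
    and "\<forall>k<length vs. {vs ! k, vs ! (Suc k mod length vs)} \<in> edge ` {..<i}"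
  shows False
  using assms
proof (induction i)
  case 0
  then have "0 < length vs"
    by linarith
  then have "{vs ! 0, vs ! (Suc 0 mod length vs)} \<in> edge ` {..<0}"
    using 0 by blast
  then show ?case
    by simp
next
  case (Suc i)
  let ?n = "length vs" and ?d = "\<lambda>k. {vs ! k, vs ! (Suc k mod length vs)}"
  have "\<exists>k<?n. ?d k = edge i"
  proof (rule ccontr)
    assume no: "\<not> (\<exists>k<?n. ?d k = edge i)"
    have "?d k \<in> edge ` {..<i}" if "k < ?n" for k
      using Suc.prems(4) no that by (auto simp: lessThan_Suc)
    then show False
      using Suc by simp
  qed
  then obtain k where k: "k < ?n" "?d k = edge i"
    by blast
  have other: "?d j \<noteq> edge i" if j: "j < ?n" "j \<noteq> k" for j
  proof
    assume "?d j = edge i"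
    then have eq: "?d j = ?d k"
      using k by simp
    have lt: "Suc j mod ?n < ?n" "Suc k mod ?n < ?n"
      using j by (auto intro!: mod_less_divisor)
    have "vs ! j \<noteq> vs ! k"
      using Suc.prems(3) j k by (simp add: nth_eq_iff_index_eq)
    then have "vs ! j = vs ! (Suc k mod ?n)" "vs ! k = vs ! (Suc j mod ?n)"
      using eq by (auto simp: doubleton_eq_iff)
    then have "j = Suc k mod ?n" "k = Suc j mod ?n"
      using Suc.prems(3) j k lt by (simp_all add: nth_eq_iff_index_eq)
    moreover have "Suc l mod ?n = (if Suc l = ?n then 0 else Suc l)" if "l < ?n" for l
      using that by (simp add: mod_Suc)
    ultimately have "j = 0 \<and> Suc k = ?n \<or> j = Suc k" "k = 0 \<and> Suc j = ?n \<or> k = Suc j"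
      using j(1) k(1) by metis+
    then show False
      using Suc.prems(2) by linarith
  qed
  have i: "i < length ps"
    using Suc.prems(1) by simp
  have "same_block (ps ! i) (vs ! k) (vs ! (Suc k mod ?n))"
  proof (rule cycle_closes)
    fix j assume j: "j < ?n" "j \<noteq> k"
    then have "?d j \<in> edge ` {..<i}"
      using Suc.prems(4) other[OF j] by (auto simp: lessThan_Suc)
    then obtain l where l: "l < i" "?d j = edge l"
      by auto
    obtain Z where "Z \<in> ps ! i" "edge l \<subseteq> Z"
      using edge_in_block[OF l(1) i] by blast
    then show "same_block (ps ! i) (vs ! j) (vs ! (Suc j mod ?n))"
      using l unfolding same_block_def by (metis insert_subset)
  next
    show "same_block (ps ! i) x z" if "same_block (ps ! i) x y" "same_block (ps ! i) y z" for x y z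
      using same_block_trans[OF part[OF i] that] .
  qed (use k Suc.prems(2) same_block_sym in auto)
  then obtain Z where "Z \<in> ps ! i" "?d k \<subseteq> Z"
    unfolding same_block_def by auto
  then show False
    using edge_not_in_block[OF Suc.prems(1)] k by simp
qed

text \<open>The earlier edge lies inside a block \<open>Z\<close> of the partition at step \<open>j\<close>.  If \<open>Z\<close> is one of the merged
  blocks, the new edge avoids its chords; otherwise \<open>Z\<close> and the merged block are different blocks
  of a noncrossing partition.\<close>

lemma edges_do_not_cross:
  assumes "i < j" "Suc j < length ps"
  shows "\<not> crosses (edge i) (edge j) \<and> \<not> crosses (edge j) (edge i)"
proof -
  obtain X Y x y where m: "X \<in> ps ! j" "Y \<in> ps ! j" "ps ! Suc j = merge_blocks (ps ! j) X Y"
    "x \<in> X" "y \<in> Y" "edge j = {x, y}" "\<forall>Z\<in>{X, Y}. \<not> crosses {x, y} Z \<and> \<not> crosses Z {x, y}"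
    using edge_obtain[OF assms(2)] by metis
  obtain Z where Z: "Z \<in> ps ! j" "edge i \<subseteq> Z"
    using edge_in_block[of i j] assms by auto
  show ?thesis
  proof (cases "Z \<in> {X, Y}")
    case True
    then show ?thesis
      using m(6,7) crosses_mono[OF _ Z(2) order_refl] crosses_mono[OF _ order_refl Z(2)] by metis
  next
    case False
    then have mem: "Z \<in> ps ! Suc j" "X \<union> Y \<in> ps ! Suc j"
      using Z m(3) by (auto simp: merge_blocks_def)
    have "Z \<noteq> X \<union> Y"
      using False partition_block_unique[OF part[OF Suc_lessD[OF assms(2)]] Z(1) m(1)] m(4) by auto
    then have "\<not> crosses Z (X \<union> Y)" "\<not> crosses (X \<union> Y) Z"
      using noncrossing[OF assms(2)] mem noncrossing_partitions_iff by metis+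
    moreover have "edge j \<subseteq> X \<union> Y"
      using m by auto
    ultimately show ?thesis
      using crosses_mono Z(2) by metis
  qed
qed

lemma segments_meet_in_common_end:
  assumes d: "d \<subseteq> V" "card d = 2" and d': "d' \<subseteq> V" "card d' = 2" and ne: "d \<noteq> d'"
    and nc: "\<not> crosses d d' \<and> \<not> crosses d' d"
  shows "convex hull d \<inter> convex hull d' = {} \<or> (\<exists>v\<in>d \<inter> d'. convex hull d \<inter> convex hull d' = {v})"
proof (cases "d \<inter> d' = {}")
  case True
  then show ?thesis
    using disjnt_convex_hulls_iff[OF d(1) d'(1)] nc by (simp add: disjnt_def)
next
  case False
  then obtain v where v: "v \<in> d" "v \<in> d'"
    by blast
  obtain p where p: "d = {v, p}" "p \<noteq> v"
    using d(2) v(1) by (auto simp: card_2_iff doubleton_eq_iff)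
  obtain q where q: "d' = {v, q}" "q \<noteq> v"
    using d'(2) v(2) by (auto simp: card_2_iff doubleton_eq_iff)
  have "p \<noteq> q"
    using ne p q by blast
  have "orient v p q \<noteq> 0"
  proof -
    have V: "v \<in> V" "p \<in> V" "q \<in> V"
      using p q d d' by auto
    have "pos v \<noteq> pos p" "pos v \<noteq> pos q" "pos p \<noteq> pos q"
      using V p(2) q(2) \<open>p \<noteq> q\<close> pos_eq by metis+
    then consider "pos v < pos p" "pos p < pos q" | "pos v < pos q" "pos q < pos p"
      | "pos q < pos v" "pos v < pos p" | "pos p < pos v" "pos v < pos q"
      | "pos p < pos q" "pos q < pos v" | "pos q < pos p" "pos p < pos v"
      by linarith
    moreover have "orient v p q = orient p q v" "orient v p q = orient q v p"
      "orient v p q = - orient v q p" "orient v p q = - orient p v q" "orient v p q = - orient q p v"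
      unfolding orient_def by (simp_all add: algebra_simps)
    ultimately show ?thesis
      using clockwise V by cases (metis less_irrefl neg_0_less_iff_less neg_less_0_iff_less)+
  qed
  have "z = v" if z: "z \<in> convex hull d" "z \<in> convex hull d'" for z
  proof -
    obtain s where s: "z = (1 - s) *\<^sub>R v + s *\<^sub>R p"
      using z(1) p by (auto simp: segment_convex_hull[symmetric] in_segment)
    obtain t where t: "z = (1 - t) *\<^sub>R v + t *\<^sub>R q"
      using z(2) q by (auto simp: segment_convex_hull[symmetric] in_segment)
    have "orient v p z = 0"
      unfolding s by (simp add: orient_affine)
    moreover have "orient v p z = t * orient v p q"
      unfolding t by (simp add: orient_affine)
    ultimately have "t = 0"
      using \<open>orient v p q \<noteq> 0\<close> by simp
    then show ?thesis
      using t by simp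
  qed
  moreover have "v \<in> convex hull d" "v \<in> convex hull d'"
    using v hull_inc by metis+
  ultimately show ?thesis
    using v by blast
qed

theorem properly_ordered_label: "properly_ordered_noncrossing_tree V label"
  unfolding properly_ordered_noncrossing_tree_def
proof (intro conjI)
  show "distinct label"
    by (rule distinct_label)
  have len: "length ps - 1 < length ps"
    using ps_nonempty by simp
  show "edge_product label = nc_perm (nc_top V)"
    unfolding label_def edge_product_prefix[OF len] last ..
  have edges: "d \<subseteq> V \<and> card d = 2" if d: "d \<in> set label" for d
  proof -
    obtain i where i: "Suc i < length ps" "d = edge i"
      using d in_set_label by blast
    obtain x y where "edge i = {x, y}" "x \<noteq> y" "x \<in> V" "y \<in> V"
      using edge_ends[OF i(1)] by metis
    then show ?thesis
      using i by simp
  qed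
  show "noncrossing_tree V (set label)"
    unfolding noncrossing_tree_def is_tree_def
  proof (intro conjI ballI impI)
    show "V \<noteq> {}"
      by (rule V_nonempty)
    show "d \<subseteq> V" "card d = 2" if "d \<in> set label" for d
      using edges[OF that] by auto
    show "(u, v) \<in> {(x, y). {x, y} \<in> set label}\<^sup>*" if "u \<in> V" "v \<in> V" for u v
    proof -
      have "same_block (ps ! (length ps - 1)) u v"
        unfolding last using that by (simp add: same_block_def nc_top_def)
      from connected_prefix[OF len this] show ?thesis
        unfolding set_label .
    qed
    show "\<nexists>vs. 3 \<le> length vs \<and> distinct vs \<and>
        (\<forall>i<length vs. {vs ! i, vs ! (Suc i mod length vs)} \<in> set label)"
      using acyclic_prefix[OF len] unfolding set_label by blast
    show "convex hull d \<inter> convex hull d' = {} \<or> (\<exists>v\<in>d \<inter> d'. convex hull d \<inter> convex hull d' = {v})"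
      if d: "d \<in> set label" and d': "d' \<in> set label" and ne: "d \<noteq> d'" for d d'
    proof -
      obtain i j where ij: "Suc i < length ps" "d = edge i" "Suc j < length ps" "d' = edge j"
        using d d' in_set_label by metis
      then have "i < j \<or> j < i"
        using ne by (metis linorder_neqE_nat)
      then have "\<not> crosses d d' \<and> \<not> crosses d' d"
        using edges_do_not_cross ij by blast
      then show ?thesis
        using edges[OF d] edges[OF d'] ne by (intro segments_meet_in_common_end) auto
    qed
  qed
qed

end

section \<open>Chains as lists\<close>

lemma sorted_wrt_unique:
  assumes "antisymp_on (set ps) r"
    and "sorted_wrt (\<lambda>x y. r x y \<and> x \<noteq> y) ps" and "sorted_wrt (\<lambda>x y. r x y \<and> x \<noteq> y) qs"
    and "set ps = set qs"
  shows "ps = qs"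
  using assms
proof (induction ps arbitrary: qs)
  case Nil
  then show ?case
    by simp
next
  case (Cons p ps)
  then obtain q qs' where qs: "qs = q # qs'"
    by (cases qs) auto
  have "p = q"
  proof (rule ccontr)
    assume ne: "p \<noteq> q"
    then have "p \<in> set qs'" "q \<in> set ps"
      using Cons.prems(4) unfolding qs by (metis set_ConsD list.set_intros(1))+
    then have "r q p" "r p q"
      using Cons.prems(2,3) unfolding qs by auto
    then show False
      using ne Cons.prems(1) \<open>q \<in> set ps\<close> by (auto simp: antisymp_on_def)
  qed
  moreover have "p \<notin> set ps" "q \<notin> set qs'"
    using Cons.prems(2,3) unfolding qs by auto
  ultimately have "set ps = set qs'"
    using Cons.prems(4) unfolding qs by auto
  moreover have "antisymp_on (set ps) r"
    using Cons.prems(1) by (rule antisymp_on_subset) auto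
  ultimately have "ps = qs'"
    using Cons.prems(2,3) Cons.IH[of qs'] unfolding qs by simp
  then show ?case
    using \<open>p = q\<close> qs by simp
qed

lemma sorted_wrt_exists:
  assumes "finite C" "transp_on C r" "antisymp_on C r" "\<forall>x\<in>C. \<forall>y\<in>C. r x y \<or> r y x"
  shows "\<exists>ps. sorted_wrt (\<lambda>x y. r x y \<and> x \<noteq> y) ps \<and> set ps = C"
  using assms
proof (induction "card C" arbitrary: C)
  case 0
  then show ?case
    by auto
next
  case (Suc n)
  then have "C \<noteq> {}"
    by auto
  then obtain x where x: "x \<in> C" "\<And>y. y \<in> C \<Longrightarrow> r y x \<Longrightarrow> y = x"
    using minimal_element[OF Suc.prems(1) _ Suc.prems(2,3)] by metis
  have "n = card (C - {x})"
    using Suc x by simp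
  then have "\<exists>ps. sorted_wrt (\<lambda>x y. r x y \<and> x \<noteq> y) ps \<and> set ps = C - {x}"
  proof (rule Suc.hyps(1))
    show "transp_on (C - {x}) r" "antisymp_on (C - {x}) r"
      using Suc.prems(2,3) by (blast intro: transp_on_subset antisymp_on_subset)+
  qed (use Suc.prems in auto)
  then obtain ps where ps: "sorted_wrt (\<lambda>x y. r x y \<and> x \<noteq> y) ps" "set ps = C - {x}"
    by blast
  have "r x y \<and> x \<noteq> y" if "y \<in> set ps" for y
    using that x Suc.prems(4) ps(2) by (metis DiffE insertI1)
  then have "sorted_wrt (\<lambda>x y. r x y \<and> x \<noteq> y) (x # ps) \<and> set (x # ps) = C"
    using ps x(1) by auto
  then show ?case
    by blast
qed

section \<open>Meets of noncrossing partitions\<close>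

definition partition_meet :: "'a set set \<Rightarrow> 'a set set \<Rightarrow> 'a set set" where
  "partition_meet \<pi> \<rho> = {B \<inter> C | B C. B \<in> \<pi> \<and> C \<in> \<rho>} - {{}}"

lemma partition_on_meet:
  assumes "partition_on V \<pi>" "partition_on V \<rho>"
  shows "partition_on V (partition_meet \<pi> \<rho>)"
proof (rule partition_onI)
  show "\<Union> (partition_meet \<pi> \<rho>) = V"
  proof (intro subset_antisym subsetI)
    fix v assume "v \<in> V"
    then obtain B C where "B \<in> \<pi>" "v \<in> B" "C \<in> \<rho>" "v \<in> C"
      using partition_block_exists assms by metis
    then show "v \<in> \<Union> (partition_meet \<pi> \<rho>)"
      unfolding partition_meet_def by blast
  next
    fix v assume "v \<in> \<Union> (partition_meet \<pi> \<rho>)"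
    then obtain B where "B \<in> \<pi>" "v \<in> B"
      unfolding partition_meet_def by blast
    then show "v \<in> V"
      using partition_block_subset assms(1) by blast
  qed
  show "disjnt A B" if "A \<in> partition_meet \<pi> \<rho>" "B \<in> partition_meet \<pi> \<rho>" "A \<noteq> B" for A B
  proof -
    obtain A1 A2 B1 B2 where AB: "A = A1 \<inter> A2" "B = B1 \<inter> B2"
      "A1 \<in> \<pi>" "B1 \<in> \<pi>" "A2 \<in> \<rho>" "B2 \<in> \<rho>"
      using \<open>A \<in> _\<close> \<open>B \<in> _\<close> unfolding partition_meet_def by blast
    then have "A1 \<noteq> B1 \<or> A2 \<noteq> B2"
      using that(3) by blast
    then show ?thesis
      using AB partition_block_unique[OF assms(1)] partition_block_unique[OF assms(2)]
      unfolding disjnt_iff by (metis IntE)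
  qed
qed (simp add: partition_meet_def)

lemma partition_meet_refines:
  assumes "partition_on V \<pi>" "partition_on V \<rho>"
  shows "refines V (partition_meet \<pi> \<rho>) \<pi>" "refines V (partition_meet \<pi> \<rho>) \<rho>"
  using assms partition_on_meet[OF assms] unfolding refines_def partition_meet_def by blast+

lemma refines_partition_meet:
  assumes "refines V \<sigma> \<pi>" "refines V \<sigma> \<rho>"
  shows "refines V \<sigma> (partition_meet \<pi> \<rho>)"
proof -
  have part: "partition_on V \<sigma>" "partition_on V \<pi>" "partition_on V \<rho>"
    using assms by (auto simp: refines_def)
  have "\<exists>C\<in>partition_meet \<pi> \<rho>. S \<subseteq> C" if S: "S \<in> \<sigma>" for S
  proof -
    obtain B where B: "B \<in> \<pi>" "S \<subseteq> B"
      using assms(1) S unfolding refines_def by blast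
    obtain C where C: "C \<in> \<rho>" "S \<subseteq> C"
      using assms(2) S unfolding refines_def by blast
    have "S \<noteq> {}"
      using part(1) S by (auto simp: partition_on_def)
    then have "B \<inter> C \<in> partition_meet \<pi> \<rho>"
      using B C unfolding partition_meet_def by blast
    then show ?thesis
      using B C by blast
  qed
  then show ?thesis
    using part partition_on_meet[OF part(2,3)] unfolding refines_def by simp
qed

section \<open>The polygon with a boundary edge\<close>

locale clockwise_polygon_edge = clockwise_polygon +
  fixes a b :: complex
  assumes ends: "a \<in> V" "b \<in> V" and b_first: "v \<in> V \<Longrightarrow> pos b \<le> pos v"
    and a_last: "v \<in> V \<Longrightarrow> pos v \<le> pos a" and card_V: "3 \<le> card V"
begin

definition inner_partitions :: "complex set set set" where
  "inner_partitions = noncrossing_partitions V - {nc_bot V, nc_top V}"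

text \<open>Every saturated chain starts with \<open>a\<close> as a singleton block and ends with \<open>a\<close> and \<open>b\<close> together;
  these are the partitions between the two regimes.\<close>

definition middle :: "complex set set set" where
  "middle = {\<pi> \<in> noncrossing_partitions V. {a} \<notin> \<pi> \<and> \<not> same_block \<pi> a b}"

lemma third_vertex:
  obtains c where "c \<in> V" "c \<noteq> a" "c \<noteq> b"
proof -
  have "card {a, b} < card V"
    using card_V by (simp add: card_insert_if)
  then have "\<not> V \<subseteq> {a, b}"
    by (metis card_mono finite.emptyI finite.insertI not_le)
  then show thesis
    using that by blast
qed

lemma a_neq_b: "a \<noteq> b"
proof
  assume "a = b"
  obtain c where c: "c \<in> V" "c \<noteq> a"
    using third_vertex by blast
  then have "pos c = pos a"
    using a_last[OF c(1)] b_first[OF c(1)] \<open>a = b\<close> by simp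
  then show False
    using c ends pos_eq by blast
qed

lemma pos_less_a: "\<lbrakk>v \<in> V; v \<noteq> a\<rbrakk> \<Longrightarrow> pos v < pos a"
  using a_last pos_eq ends by (metis le_neq_implies_less)

lemma pos_greater_b: "\<lbrakk>v \<in> V; v \<noteq> b\<rbrakk> \<Longrightarrow> pos b < pos v"
  using b_first pos_eq ends by (metis le_neq_implies_less)

lemma middle_subset: "middle \<subseteq> inner_partitions"
proof
  fix \<pi> assume \<pi>: "\<pi> \<in> middle"
  have "{a} \<in> nc_bot V" "same_block (nc_top V) a b"
    using ends by (auto simp: nc_bot_def nc_top_def same_block_def)
  then show "\<pi> \<in> inner_partitions"
    using \<pi> unfolding middle_def inner_partitions_def by auto
qed

lemma singleton_a_mono:
  assumes "refines V \<pi> \<pi>'" "{a} \<in> \<pi>'"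
  shows "{a} \<in> \<pi>"
proof -
  have part: "partition_on V \<pi>" "partition_on V \<pi>'"
    using assms(1) by (auto simp: refines_def)
  obtain B where B: "B \<in> \<pi>" "a \<in> B"
    using partition_block_exists[OF part(1) ends(1)] by blast
  obtain C where C: "C \<in> \<pi>'" "B \<subseteq> C"
    using assms(1) B(1) unfolding refines_def by blast
  then have "C = {a}"
    using partition_block_unique[OF part(2) C(1) assms(2)] B(2) by auto
  then have "B = {a}"
    using B(2) C(2) by blast
  then show ?thesis
    using B(1) by simp
qed

lemma finite_nc: "finite (noncrossing_partitions V)"
proof (rule finite_subset)
  show "noncrossing_partitions V \<subseteq> Pow (Pow V)"
    by (auto simp: noncrossing_partitions_def partition_on_def)
qed (simp add: finite_V)

lemma convex_part_middle: "convex_part (refines V) inner_partitions middle"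
proof
  show "finite inner_partitions"
    using finite_nc by (simp add: inner_partitions_def)
  show "middle \<subseteq> inner_partitions"
    by (rule middle_subset)
  show "refines V \<pi> \<pi>" if "\<pi> \<in> inner_partitions" for \<pi>
    using that nc_partition_on refines_refl by (auto simp: inner_partitions_def)
  show "\<rho> \<in> middle" if "\<pi> \<in> middle" "\<pi>' \<in> middle" "\<rho> \<in> inner_partitions"
      "refines V \<pi> \<rho>" "refines V \<rho> \<pi>'" for \<pi> \<pi>' \<rho>
    using that singleton_a_mono[OF that(4)] same_block_refines[OF that(5)]
    by (auto simp: middle_def inner_partitions_def)
qed (metis refines_trans refines_asym)+

lemma meet_noncrossing:
  assumes "\<pi> \<in> noncrossing_partitions V" "\<rho> \<in> noncrossing_partitions V"
  shows "partition_meet \<pi> \<rho> \<in> noncrossing_partitions V"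
  unfolding noncrossing_partitions_iff
proof (intro conjI ballI impI)
  show "partition_on V (partition_meet \<pi> \<rho>)"
    using assms nc_partition_on partition_on_meet by blast
  fix A B assume AB: "A \<in> partition_meet \<pi> \<rho>" "B \<in> partition_meet \<pi> \<rho>" "A \<noteq> B"
  obtain A1 A2 B1 B2 where eq: "A = A1 \<inter> A2" "B = B1 \<inter> B2"
    and mem: "A1 \<in> \<pi>" "B1 \<in> \<pi>" "A2 \<in> \<rho>" "B2 \<in> \<rho>"
    using AB(1,2) unfolding partition_meet_def by blast
  then consider "A1 \<noteq> B1" | "A2 \<noteq> B2"
    using AB(3) by blast
  then show "\<not> crosses A B"
  proof cases
    case 1
    then have "\<not> crosses A1 B1"
      using assms(1) mem noncrossing_partitions_iff by blast
    then show ?thesis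
      using crosses_mono[of A B A1 B1] eq by blast
  next
    case 2
    then have "\<not> crosses A2 B2"
      using assms(2) mem noncrossing_partitions_iff by blast
    then show ?thesis
      using crosses_mono[of A B A2 B2] eq by blast
  qed
qed

text \<open>Cuts the polygon by a line behind the vertex \<open>y\<close>, with \<open>b\<close> and \<open>a\<close> on different sides unless \<open>y = a\<close>.\<close>

definition cut :: "complex \<Rightarrow> complex set set" where
  "cut y = {{u \<in> V. pos u \<le> pos y}, {u \<in> V. pos y < pos u}}"

lemma cut_noncrossing:
  assumes y: "y \<in> V" "y \<noteq> a"
  shows "cut y \<in> noncrossing_partitions V"
  unfolding noncrossing_partitions_iff
proof (intro conjI ballI impI)
  have "a \<in> {u \<in> V. pos y < pos u}" "y \<in> {u \<in> V. pos u \<le> pos y}"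
    using ends y pos_less_a by auto
  then show "partition_on V (cut y)"
    unfolding cut_def by (intro partition_onI) (auto simp: disjnt_iff)
  show "\<not> crosses A B" if "A \<in> cut y" "B \<in> cut y" "A \<noteq> B" for A B
    using that unfolding cut_def crosses_def by fastforce
qed

lemma cut_separates: "\<lbrakk>y \<in> V; y \<noteq> a\<rbrakk> \<Longrightarrow> \<not> same_block (cut y) a b"
  using pos_less_a b_first unfolding same_block_def cut_def by fastforce

lemma cut_in_middle:
  assumes y: "y \<in> V" "y \<noteq> a" and x: "x \<in> V" "x \<noteq> a" "pos y < pos x"
  shows "cut y \<in> middle"
proof -
  have "{a} \<noteq> {u \<in> V. pos u \<le> pos y}"
    using y by auto
  moreover have "{a} \<noteq> {u \<in> V. pos y < pos u}"
    using x by auto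
  ultimately show ?thesis
    using cut_noncrossing[OF y] cut_separates[OF y] unfolding middle_def cut_def by auto
qed

lemma middle_nonempty: "middle \<noteq> {}"
proof -
  obtain c where "c \<in> V" "c \<noteq> a" "c \<noteq> b"
    by (rule third_vertex)
  then have "cut b \<in> middle"
    using cut_in_middle[of b c] ends a_neq_b pos_greater_b by metis
  then show ?thesis
    by blast
qed

text \<open>Let \<open>Y\<close> be the block of \<open>b\<close> in \<open>\<sigma>\<close> and \<open>y\<close> its last vertex.  No block of \<open>\<sigma>\<close> passes across the cut
  behind \<open>y\<close>, since it would cross \<open>Y\<close>.  If \<open>m\<close> in \<open>middle\<close> lies above \<open>\<sigma>\<close>, the block of \<open>a\<close> in \<open>m\<close>
  has a further vertex \<open>x\<close>, and \<open>x\<close> lies behind \<open>y\<close>, since otherwise this block would cross the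
  block of \<open>b\<close>.  So for \<open>\<pi>\<close> above \<open>m\<close> the meet with the cut keeps \<open>a\<close> together with \<open>x\<close>, separates
  \<open>a\<close> from \<open>b\<close>, and is again in \<open>middle\<close>.\<close>

lemma meets_with_element_above:
  assumes \<sigma>: "\<sigma> \<in> noncrossing_partitions V" "{a} \<in> \<sigma>" and m0: "m0 \<in> middle" "refines V \<sigma> m0"
  shows "meets_with_element (refines V)
    {\<pi> \<in> inner_partitions. \<exists>m\<in>middle. refines V \<sigma> m \<and> refines V m \<pi>}" (is "meets_with_element _ ?R")
proof -
  have part: "partition_on V \<sigma>"
    using \<sigma>(1) by (rule nc_partition_on)
  obtain Y where Y: "Y \<in> \<sigma>" "b \<in> Y"
    using partition_block_exists[OF part ends(2)] by blast
  have YV: "Y \<subseteq> V"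
    using part Y(1) by (rule partition_block_subset)
  obtain y where y: "y \<in> Y" and y_max: "\<And>u. u \<in> Y \<Longrightarrow> pos u \<le> pos y"
    using pos_greatest[of Y] Y YV by blast
  have yV: "y \<in> V"
    using y YV by blast
  have ya: "y \<noteq> a"
    using partition_block_unique[OF part Y(1) \<sigma>(2)] y Y(2) a_neq_b by auto
  have \<sigma>_cut: "refines V \<sigma> (cut y)"
    unfolding refines_def
  proof (intro conjI ballI)
    show "partition_on V (cut y)"
      using cut_noncrossing[OF yV ya] by (rule nc_partition_on)
    fix Z assume Z: "Z \<in> \<sigma>"
    have ZV: "Z \<subseteq> V"
      using part Z by (rule partition_block_subset)
    have "False" if p: "p \<in> Z" "pos p \<le> pos y" and q: "q \<in> Z" "pos y < pos q" for p q
    proof -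
      have "Z \<noteq> Y"
        using q y_max[of q] by auto
      then have "p \<notin> Y" and nc: "\<not> crosses Y Z"
        using partition_block_unique[OF part Z Y(1) p(1)] \<sigma>(1) Z Y(1) noncrossing_partitions_iff by blast+
      then have "pos p \<noteq> pos y" "p \<noteq> b"
        using y Y(2) p(1) ZV yV pos_eq[of p y] by auto
      then have "pos b < pos p" "pos p < pos y"
        using p ZV pos_greater_b by auto
      then show False
        using nc Y(2) y p q unfolding crosses_def by blast
    qed
    then have "(\<forall>p\<in>Z. pos p \<le> pos y) \<or> (\<forall>q\<in>Z. pos y < pos q)"
      by (meson not_le)
    then show "\<exists>B\<in>cut y. Z \<subseteq> B"
      using ZV unfolding cut_def by auto
  qed (rule part)
  (* x keeps {a} from being a block of the meet with the cut *)
  have companion: "\<exists>x\<in>V. x \<noteq> a \<and> pos y < pos x \<and> same_block m x a" if m: "m \<in> middle" "refines V \<sigma> m" for m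
  proof -
    have m_nc: "m \<in> noncrossing_partitions V" and m_a: "{a} \<notin> m" and m_ab: "\<not> same_block m a b"
      using m(1) by (auto simp: middle_def)
    note m_part = nc_partition_on[OF m_nc]
    obtain X where X: "X \<in> m" "a \<in> X"
      using partition_block_exists[OF m_part ends(1)] by blast
    obtain x where x: "x \<in> X" "x \<noteq> a"
      using X m_a by (metis all_not_in_conv insertI1 subsetI subset_singletonD)
    obtain Y' where Y': "Y' \<in> m" "Y \<subseteq> Y'"
      using m(2) Y(1) unfolding refines_def by blast
    have "X \<noteq> Y'"
      using m_ab X Y' Y(2) unfolding same_block_def by blast
    then have nc: "\<not> crosses Y' X"
      using m_nc X(1) Y'(1) by (simp add: noncrossing_partitions_iff)
    have "x \<notin> Y'"
      using partition_block_unique[OF m_part X(1) Y'(1) x(1)] \<open>X \<noteq> Y'\<close> by blast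
    have xV: "x \<in> V"
      using partition_block_subset[OF m_part X(1)] x(1) by blast
    have "pos x \<noteq> pos y" "x \<noteq> b"
      using \<open>x \<notin> Y'\<close> Y' y Y(2) xV yV pos_eq[of x y] by auto
    have "pos y < pos x"
    proof (rule ccontr)
      assume "\<not> pos y < pos x"
      then have "pos b < pos x" "pos x < pos y" "pos y < pos a"
        using \<open>pos x \<noteq> pos y\<close> \<open>x \<noteq> b\<close> xV pos_greater_b pos_less_a[OF yV ya] by auto
      then show False
        using nc Y' Y(2) y x(1) X(2) unfolding crosses_def by blast
    qed
    then show ?thesis
      using x X xV unfolding same_block_def by blast
  qed
  have cut: "cut y \<in> middle"
    using companion[OF m0] cut_in_middle[OF yV ya] by blast
  then have cut_nc: "cut y \<in> noncrossing_partitions V"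
    by (simp add: middle_def)
  note cut_part = nc_partition_on[OF cut_nc]
  have "cut y \<in> ?R"
    using cut middle_subset \<sigma>_cut refines_refl[OF cut_part] by blast
  moreover have "\<exists>z\<in>?R. refines V z \<pi> \<and> refines V z (cut y) \<and>
      (\<forall>w\<in>?R. refines V w \<pi> \<and> refines V w (cut y) \<longrightarrow> refines V w z)" if \<pi>: "\<pi> \<in> ?R" for \<pi>
  proof -
    let ?z = "partition_meet \<pi> (cut y)"
    have \<pi>_nc: "\<pi> \<in> noncrossing_partitions V"
      using \<pi> by (auto simp: inner_partitions_def)
    note \<pi>_part = nc_partition_on[OF \<pi>_nc]
    note z_le = partition_meet_refines[OF \<pi>_part cut_part]
    obtain m where m: "m \<in> middle" "refines V \<sigma> m" "refines V m \<pi>"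
      using \<pi> by blast
    obtain x where x: "x \<in> V" "x \<noteq> a" "pos y < pos x" "same_block \<pi> x a"
      using companion[OF m(1,2)] same_block_refines[OF m(3)] by blast
    have "{a} \<notin> ?z"
    proof
      assume "{a} \<in> ?z"
      then obtain B C where BC: "B \<in> \<pi>" "C \<in> cut y" "{a} = B \<inter> C"
        unfolding partition_meet_def by auto
      have "x \<in> B"
        using x(4) BC partition_block_unique[OF \<pi>_part BC(1)] unfolding same_block_def by blast
      moreover have "x \<in> C"
      proof -
        have "a \<in> C"
          using BC(3) by blast
        then have "C = {u \<in> V. pos y < pos u}"
          using BC(2) pos_less_a[OF yV ya] unfolding cut_def by auto
        then show ?thesis
          using x by simp
      qed
      ultimately have "x \<in> {a}"
        unfolding BC(3) by simp
      then show False
        using x(2) by simp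
    qed
    moreover have "\<not> same_block ?z a b"
      using same_block_refines[OF z_le(2)] cut_separates[OF yV ya] by blast
    ultimately have z_mid: "?z \<in> middle"
      using meet_noncrossing[OF \<pi>_nc cut_nc] by (simp add: middle_def)
    have "refines V \<sigma> ?z"
      using refines_trans[OF m(2,3)] \<sigma>_cut by (rule refines_partition_meet)
    moreover have "refines V ?z ?z"
      using z_le(1) refines_refl unfolding refines_def by blast
    ultimately have "?z \<in> ?R"
      using z_mid middle_subset by blast
    then show ?thesis
      using z_le refines_partition_meet by blast
  qed
  ultimately show ?thesis
    unfolding meets_with_element_def by blast
qed

text \<open>The upper part of the poset is the case of \<open>meets_with_element_above\<close> in which \<open>\<sigma>\<close> is the least
  partition.\<close>

theorem contractible_chains_meeting_middle:
  "contractible_complex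
     {C \<in> nc_link V. \<exists>m\<in>middle. insert m C \<in> nc_link V}"
proof -
  interpret convex_part "refines V" inner_partitions middle
    by (rule convex_part_middle)
  have "V \<noteq> {}"
    using ends by blast
  have mid_nc: "m \<in> noncrossing_partitions V" if "m \<in> middle" for m
    using that by (simp add: middle_def)
  have "upper = {\<pi> \<in> inner_partitions. \<exists>m\<in>middle. refines V (nc_bot V) m \<and> refines V m \<pi>}"
    unfolding upper_def using nc_bot_least(2)[OF mid_nc] by auto
  moreover have "{a} \<in> nc_bot V"
    using ends by (simp add: nc_bot_def)
  ultimately have "meets_with_element (refines V) upper"
    using meets_with_element_above[OF nc_bot_least(1)] nc_bot_least(2)[OF mid_nc] middle_nonempty
    by (metis all_not_in_conv)
  moreover have "meets_with_element (refines V) (upper_above \<sigma>)" if low: "\<sigma> \<in> lower" for \<sigma>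
  proof -
    obtain m where m: "m \<in> middle" "refines V \<sigma> m"
      using low by (auto simp: lower_def)
    have \<sigma>: "\<sigma> \<in> inner_partitions" "\<sigma> \<notin> upper"
      using low by (auto simp: lower_def)
    have "\<not> same_block \<sigma> a b"
      using m(1) same_block_refines[OF m(2)] by (auto simp: middle_def)
    moreover have "\<sigma> \<notin> middle"
      using \<sigma> refl unfolding upper_def by blast
    ultimately have "{a} \<in> \<sigma>"
      using \<sigma> by (auto simp: middle_def inner_partitions_def)
    moreover have "\<sigma> \<in> noncrossing_partitions V"
      using \<sigma>(1) by (simp add: inner_partitions_def)
    ultimately show ?thesis
      using meets_with_element_above[OF _ _ m] unfolding upper_above_def by simp
  qed
  ultimately have "contractible_complex compatible_chains"
    by (rule contractible_compatible_chains)
  then show ?thesis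
    unfolding compatible_chains_def unfolding nc_link_def inner_partitions_def .
qed

end

section \<open>Which labels avoid the boundary edge\<close>

locale saturated_chain_edge = saturated_chain V pos ps + clockwise_polygon_edge V pos a b
  for V pos ps a b
begin

text \<open>In the edge \<open>{x, y}\<close> of a merge, \<open>y\<close> is the first vertex of the block \<open>Y\<close> that starts later.  So
  \<open>{x, y} = {a, b}\<close> forces \<open>y = a\<close>, and then \<open>Y\<close> is \<open>{a}\<close> because \<open>a\<close> is the last vertex.\<close>

lemma edge_eq_iff:
  assumes i: "Suc i < length ps"
  shows "edge i = {a, b} \<longleftrightarrow> {a} \<in> ps ! i \<and> same_block (ps ! Suc i) a b"
proof -
  note p = part[OF Suc_lessD[OF i]]
  obtain X Y x y x0 where m: "X \<in> ps ! i" "Y \<in> ps ! i" "X \<noteq> Y" "ps ! Suc i = merge_blocks (ps ! i) X Y"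
    and x0: "x0 \<in> X" "\<forall>u\<in>Y. pos x0 < pos u"
    and xy: "x \<in> X" "y \<in> Y" "\<forall>u\<in>Y. pos y \<le> pos u" "(\<forall>u\<in>X. pos x \<le> pos u) \<or> pos y < pos x"
    and e: "edge i = {x, y}"
    by (rule edge_obtain[OF i])
  have sub: "X \<subseteq> V" "Y \<subseteq> V"
    using partition_block_subset[OF p] m by blast+
  show ?thesis
  proof
    assume "edge i = {a, b}"
    moreover have "y \<noteq> b"
      using x0 xy(2) b_first[of x0] sub by fastforce
    ultimately have "y = a" "x = b"
      using e by (auto simp: doubleton_eq_iff)
    have "u = a" if "u \<in> Y" for u
      using that xy(3) \<open>y = a\<close> sub pos_less_a[of u] by fastforce
    then have "Y = {a}"
      using xy(2) \<open>y = a\<close> by blast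
    moreover have "same_block (ps ! Suc i) a b"
      using m(4) xy(1,2) \<open>y = a\<close> \<open>x = b\<close> unfolding same_block_def merge_blocks_def by blast
    ultimately show "{a} \<in> ps ! i \<and> same_block (ps ! Suc i) a b"
      using m(2) by blast
  next
    assume ab: "{a} \<in> ps ! i \<and> same_block (ps ! Suc i) a b"
    have block_a: "B = {a}" if "B \<in> ps ! i" "a \<in> B" for B
      using partition_block_unique[OF p that(1) _ that(2)] ab by blast
    have "\<not> same_block (ps ! i) a b"
      using block_a a_neq_b unfolding same_block_def by blast
    then have mem: "a \<in> X \<union> Y" "b \<in> X \<union> Y"
      using ab same_block_merge_blocks m(4) by metis+
    have "a \<notin> X"
      using block_a[OF m(1)] x0 xy(2) a_last[of y] sub by fastforce
    then have "Y = {a}"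
      using mem block_a[OF m(2)] by blast
    then have "y = a" "b \<in> X"
      using xy(2) mem a_neq_b by auto
    moreover have "\<not> pos a < pos x"
      using a_last[of x] xy(1) sub by fastforce
    ultimately have "pos x \<le> pos b"
      using xy(4) by blast
    then have "x = b"
      using pos_greater_b[of x] xy(1) sub by fastforce
    then show "edge i = {a, b}"
      using e \<open>y = a\<close> by auto
  qed
qed

text \<open>Consider the step in which \<open>a\<close> stops being a singleton.  Either \<open>a\<close> is merged with the block of \<open>b\<close>, the
  edge is \<open>{a, b}\<close>, and the chain never meets \<open>middle\<close>; or the step leads into \<open>middle\<close>, and no
  other step can have the edge \<open>{a, b}\<close>.\<close>

theorem label_avoids_edge_iff: "{a, b} \<notin> set label \<longleftrightarrow> (\<exists>\<pi>\<in>set ps. \<pi> \<in> middle)"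
proof
  assume avoid: "{a, b} \<notin> set label"
  have len: "length ps - 1 < length ps"
    using ps_nonempty by simp
  have "{a} \<notin> nc_top V"
    using ends a_neq_b by (auto simp: nc_top_def)
  then have ex: "\<exists>j. j < length ps \<and> {a} \<notin> ps ! j"
    using last len by metis
  (* the step from j - 1 to j is the one in which a stops being a singleton *)
  define j where "j = (LEAST j. j < length ps \<and> {a} \<notin> ps ! j)"
  have j: "j < length ps" "{a} \<notin> ps ! j"
    using LeastI_ex[OF ex] unfolding j_def by auto
  have "{a} \<in> ps ! 0"
    using ends by (simp add: first nc_bot_def)
  then obtain i where i: "j = Suc i"
    using j(2) by (cases j) auto
  have "{a} \<in> ps ! i"
    using not_less_Least[of i "\<lambda>j. j < length ps \<and> {a} \<notin> ps ! j"] i j unfolding j_def by auto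
  moreover have "edge i \<in> set label"
    using i j unfolding in_set_label by blast
  ultimately have "\<not> same_block (ps ! j) a b"
    using avoid edge_eq_iff[of i] i j by metis
  then have "ps ! j \<in> middle"
    using noncrossing[OF j(1)] j(2) by (simp add: middle_def)
  then show "\<exists>\<pi>\<in>set ps. \<pi> \<in> middle"
    using j(1) nth_mem by blast
next
  assume "\<exists>\<pi>\<in>set ps. \<pi> \<in> middle"
  then obtain k where k: "k < length ps" "ps ! k \<in> middle"
    by (metis in_set_conv_nth)
  then have k_mid: "{a} \<notin> ps ! k" "\<not> same_block (ps ! k) a b"
    by (auto simp: middle_def)
  show "{a, b} \<notin> set label"
  proof
    assume "{a, b} \<in> set label"
    then obtain i where i: "Suc i < length ps" "edge i = {a, b}"
      unfolding in_set_label by metis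
    then have e: "{a} \<in> ps ! i" "same_block (ps ! Suc i) a b"
      using edge_eq_iff by auto
    show False
    proof (cases "k \<le> i")
      case True
      then show False
        using singleton_a_mono[OF refines_mono[OF True]] e i k_mid by auto
    next
      case False
      then show False
        using same_block_refines[OF refines_mono[of "Suc i" k]] e k k_mid by auto
    qed
  qed
qed

end

section \<open>Listing the vertices of a convex polygon\<close>

lemma extreme_points_not_in_hull:
  assumes "q extreme_point_of P" and "convex P" and "S \<subseteq> P" and "q \<notin> S"
  shows "q \<notin> convex hull S"
proof
  assume q: "q \<in> convex hull S"
  have "convex hull S \<subseteq> P"
    using assms(2,3) by (intro hull_minimal)
  then have "q extreme_point_of (convex hull S)"
    using assms(1) q unfolding extreme_point_of_def by blast
  then show False
    using extreme_point_of_convex_hull assms(4) by blast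
qed

lemma collinear_if_orient_zero:
  assumes "orient p q r = 0"
  shows "collinear {p, q, r}"
proof (cases "q = p")
  case True
  then show ?thesis
    by simp
next
  case False
  let ?d = "q - p"
  have im: "Im (cnj ?d * (r - p)) = 0"
    using assms by (simp add: orient_def)
  then have real: "cnj ?d * (r - p) = of_real (Re (cnj ?d * (r - p)))"
    by (simp add: complex_eq_iff)
  have "(r - p) * of_real ((cmod ?d)\<^sup>2) = (cnj ?d * (r - p)) * ?d"
    by (simp add: complex_norm_square mult.commute mult.left_commute del: of_real_power)
  also have "\<dots> = of_real (Re (cnj ?d * (r - p))) * ?d"
    by (subst real) (rule refl)
  finally have "(r - p) * of_real ((cmod ?d)\<^sup>2) = of_real (Re (cnj ?d * (r - p))) * ?d" .
  then have "r - p = of_real (Re (cnj ?d * (r - p))) * ?d / of_real ((cmod ?d)\<^sup>2)"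
    using False by (intro eq_divide_imp) auto
  then have "r - p = (Re (cnj ?d * (r - p)) / (cmod ?d)\<^sup>2) *\<^sub>R ?d"
    unfolding scaleR_conv_of_real of_real_divide times_divide_eq_left .
  then have "collinear {0, ?d, r - p}"
    using collinear_lemma by metis
  then show ?thesis
    using collinear_3[of q p r] by (simp add: insert_commute)
qed

lemma vertices_not_collinear:
  assumes P: "convex P" and "p \<in> vertices P" "q \<in> vertices P" "r \<in> vertices P"
    and "p \<noteq> q" "p \<noteq> r" "q \<noteq> r"
  shows "orient p q r \<noteq> 0"
proof
  assume "orient p q r = 0"
  then have "between (q, r) p \<or> between (r, p) q \<or> between (p, q) r"
    using collinear_if_orient_zero collinear_between_cases by blast
  moreover have "\<not> between (v, w) u"
    if "u \<in> vertices P" "v \<in> vertices P" "w \<in> vertices P" "u \<noteq> v" "u \<noteq> w" for u v w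
    using extreme_points_not_in_hull[of u P "{v, w}"] that P
    by (auto simp: vertices_def between_mem_convex_hull extreme_point_of_def)
  ultimately show False
    using assms by metis
qed

lemma scaled_sum_divide:
  fixes x y z :: complex
  assumes "C *\<^sub>R x = B *\<^sub>R y + A *\<^sub>R z" and "C \<noteq> 0"
  shows "x = (B / C) *\<^sub>R y + (A / C) *\<^sub>R z"
proof -
  have "x = (1 / C) *\<^sub>R (C *\<^sub>R x)"
    using assms(2) by simp
  then show ?thesis
    unfolding assms(1) by (simp add: scaleR_add_right)
qed

text \<open>Otherwise \<open>q\<close> would be a convex combination of \<open>a\<close>, \<open>p\<close> and \<open>r\<close>, with coefficients given by ratios of
  determinants.\<close>

lemma vertex_not_in_triangle:
  assumes P: "convex P" and V: "a \<in> vertices P" "p \<in> vertices P" "q \<in> vertices P" "r \<in> vertices P"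
    and ne: "q \<noteq> a" "q \<noteq> p" "q \<noteq> r"
    and neg: "orient a p q < 0" "orient a q r < 0" "orient a p r < 0"
  shows "orient p q r < 0"
proof (rule ccontr)
  define A B C where "A = - orient a p q" and "B = - orient a q r" and "C = - orient a p r"
  note defs = A_def B_def C_def
  have pos: "0 < A" "0 < B" "0 < C"
    using neg by (simp_all add: defs)
  assume "\<not> orient p q r < 0"
  moreover have "orient p q r = C - A - B"
    unfolding defs orient_def by (simp add: algebra_simps)
  ultimately have "(B + A) / C \<le> 1"
    using pos by simp
  then have "0 \<le> 1 - B / C - A / C"
    by (simp add: add_divide_distrib)
  have "C *\<^sub>R (q - a) = B *\<^sub>R (p - a) + A *\<^sub>R (r - a)"
    unfolding defs orient_def by (simp add: complex_eq_iff algebra_simps)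
  then have "q - a = (B / C) *\<^sub>R (p - a) + (A / C) *\<^sub>R (r - a)"
    by (rule scaled_sum_divide) (use pos in simp)
  then have "q = (1 - B / C - A / C) *\<^sub>R a + (B / C) *\<^sub>R p + (A / C) *\<^sub>R r"
    by (simp add: algebra_simps)
  moreover have "0 \<le> B / C" "0 \<le> A / C"
    using pos by simp_all
  ultimately have "q \<in> convex hull {a, p, r}"
    using \<open>0 \<le> 1 - B / C - A / C\<close> unfolding convex_hull_3
    by (intro CollectI exI[of _ "1 - B / C - A / C"] exI[of _ "B / C"] exI[of _ "A / C"]) auto
  moreover have "{a, p, r} \<subseteq> P"
    using V by (auto simp: vertices_def extreme_point_of_def)
  ultimately show False
    using extreme_points_not_in_hull[of q P "{a, p, r}"] V(3) P ne by (auto simp: vertices_def)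
qed

text \<open>A supporting line at the midpoint of the edge contains the whole edge, so all other vertices lie on
  one side of it; the names of the two ends are chosen accordingly.\<close>

lemma boundary_edge_side:
  assumes P: "polytope P" "aff_dim P = 2" and e: "boundary_edge P e"
  obtains a b where "e = {a, b}" "a \<in> vertices P" "b \<in> vertices P" "a \<noteq> b"
    "\<And>u. \<lbrakk>u \<in> vertices P; u \<noteq> a; u \<noteq> b\<rbrakk> \<Longrightarrow> orient a b u < 0"
proof -
  have cvx: "convex P" and "closed P"
    using P(1) polytope_imp_convex polytope_imp_closed by blast+
  obtain p q where e_eq: "e = {p, q}" "p \<noteq> q"
    using e unfolding boundary_edge_def by (auto simp: card_2_iff)
  have V: "p \<in> vertices P" "q \<in> vertices P"
    using e unfolding boundary_edge_def e_eq by auto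
  then have in_P: "p \<in> P" "q \<in> P"
    by (auto simp: vertices_def extreme_point_of_def)
  let ?m = "midpoint p q"
  have "?m \<in> convex hull e"
    unfolding e_eq by (simp add: segment_convex_hull[symmetric])
  then have "?m \<in> frontier P"
    using e unfolding boundary_edge_def by blast
  then have m: "?m \<in> P" "?m \<notin> interior P"
    using \<open>closed P\<close> by (auto simp: frontier_def)
  have "rel_interior P = interior P"
    using P(2) by (intro rel_interior_interior) (simp add: aff_dim_eq_full[symmetric])
  then obtain d where d: "d \<noteq> 0" "\<And>y. y \<in> P \<Longrightarrow> d \<bullet> ?m \<le> d \<bullet> y"
    using supporting_hyperplane_rel_boundary[OF cvx m(1)] m(2) by metis
  have mid: "2 * (d \<bullet> ?m) = d \<bullet> p + d \<bullet> q"
    by (simp add: midpoint_def inner_add_right)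
  then have dp: "d \<bullet> ?m = d \<bullet> p" and dq: "d \<bullet> q = d \<bullet> p"
    using d(2)[OF in_P(1)] d(2)[OF in_P(2)] by linarith+
  have orth: "d \<bullet> (q - p) = 0"
    using dq by (simp add: inner_diff_right)
  (* d is orthogonal to the edge, hence a real multiple of the rotated edge vector *)
  obtain k :: real where k: "d = of_real k * (\<i> * (q - p))"
  proof
    let ?w = "q - p"
    have "Re (cnj ?w * d) = 0"
      using orth by (simp add: inner_complex_def algebra_simps)
    then have turn: "cnj ?w * d = of_real (Im (cnj ?w * d)) * \<i>"
      by (simp add: complex_eq_iff)
    have "d * of_real ((cmod ?w)\<^sup>2) = (cnj ?w * d) * ?w"
      by (simp add: complex_norm_square mult.commute mult.left_commute del: of_real_power)
    also have "\<dots> = of_real (Im (cnj ?w * d)) * \<i> * ?w"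
      by (subst turn) (rule refl)
    finally have "d * of_real ((cmod ?w)\<^sup>2) = of_real (Im (cnj ?w * d)) * (\<i> * ?w)"
      by (simp only: mult.assoc)
    then have "d = of_real (Im (cnj ?w * d)) * (\<i> * ?w) / of_real ((cmod ?w)\<^sup>2)"
      using e_eq(2) by (intro eq_divide_imp) auto
    then show "d = of_real (Im (cnj ?w * d) / (cmod ?w)\<^sup>2) * (\<i> * ?w)"
      unfolding of_real_divide times_divide_eq_left .
  qed
  have side: "d \<bullet> (u - p) = k * orient p q u" for u
    unfolding k orient_def by (simp add: inner_complex_def algebra_simps)
  have "k \<noteq> 0"
    using k d(1) by auto
  have ge: "0 \<le> k * orient p q u" if "u \<in> vertices P" for u
  proof -
    have "u \<in> P"
      using that by (auto simp: vertices_def extreme_point_of_def)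
    then show ?thesis
      using d(2)[of u] dp side[of u] by (simp add: inner_diff_right)
  qed
  have ne: "orient p q u \<noteq> 0" if "u \<in> vertices P" "u \<noteq> p" "u \<noteq> q" for u
    using vertices_not_collinear[OF cvx V that(1)] e_eq(2) that by blast
  show thesis
  proof (cases "k < 0")
    case True
    have "orient p q u < 0" if "u \<in> vertices P" "u \<noteq> p" "u \<noteq> q" for u
      using ge[OF that(1)] ne[OF that] True by (auto simp: zero_le_mult_iff)
    then show thesis
      using that[of p q] e_eq V by blast
  next
    case False
    have "orient q p u < 0" if "u \<in> vertices P" "u \<noteq> q" "u \<noteq> p" for u
      using ge[OF that(1)] ne[of u] that False \<open>k \<noteq> 0\<close> orient_flip[of q p u]
      by (auto simp: zero_le_mult_iff)
    then show thesis
      using that[of q p] e_eq V by (metis insert_commute)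
  qed
qed

text \<open>The vertices are sorted by their direction as seen from \<open>a\<close>, with \<open>a\<close> itself put last.  This is a
  linear order because all directions lie within a half-plane bounded by the line \<open>ab\<close>.\<close>

lemma clockwise_listing:
  assumes P: "convex P" and fin: "finite (vertices P)" and card: "3 \<le> card (vertices P)"
    and a: "a \<in> vertices P" and b: "b \<in> vertices P" and ab: "a \<noteq> b"
    and side: "\<And>u. \<lbrakk>u \<in> vertices P; u \<noteq> a; u \<noteq> b\<rbrakk> \<Longrightarrow> orient a b u < 0"
  obtains pos where "clockwise_polygon_edge (vertices P) pos a b"
proof -
  let ?V = "vertices P"
  define less where "less p q \<longleftrightarrow> p \<noteq> a \<and> (q = a \<or> orient a p q < 0)" for p q
  have irrefl: "\<not> less p p" for p
    by (simp add: less_def)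
  have total: "less p q \<or> less q p" if "p \<in> ?V" "q \<in> ?V" "p \<noteq> q" for p q
    using vertices_not_collinear[OF P a that(1,2)] that(3) orient_swap[of a p q]
    unfolding less_def by (cases "p = a"; cases "q = a") auto
  have b_less: "less b q" if "q \<in> ?V" "q \<noteq> b" for q
    using side[OF that(1)] that ab unfolding less_def by auto
  have asym: "\<not> less q p" if "less p q" for p q
    using that orient_swap[of a p q] unfolding less_def by auto
  have trans: "less p r" if V: "p \<in> ?V" "q \<in> ?V" "r \<in> ?V" and pq: "less p q" and qr: "less q r" for p q r
  proof (cases "r = a \<or> p = b")
    case True
    then show ?thesis
      using pq qr b_less[of r] V asym b_less[of q] unfolding less_def by (metis orient_degenerate(2) less_irrefl)
  next
    case False
    then have *: "orient a p q < 0" "orient a q r < 0" "orient a b p < 0" "q \<noteq> a" "r \<noteq> a" "p \<noteq> a" "p \<noteq> b"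
      using pq qr side[of p] V unfolding less_def by auto
    have "q \<noteq> b" "r \<noteq> b"
      using asym[OF b_less] pq qr V False b_less asym by metis+
    then have **: "orient a b q < 0" "orient a b r < 0"
      using side V * by blast+
    (* the Pluecker relation for the four directions from a *)
    have "orient a b q * orient a p r = orient a b p * orient a q r + orient a b r * orient a p q"
      unfolding orient_def by (simp add: algebra_simps)
    moreover have "0 < orient a b p * orient a q r" "0 < orient a b r * orient a p q"
      using * ** by (simp_all add: mult_neg_neg)
    ultimately have "0 < orient a b q * orient a p r"
      by simp
    then have "orient a p r < 0"
      using **(1) by (simp add: zero_less_mult_iff)
    then show ?thesis
      using * unfolding less_def by blast
  qed
  define pos where "pos q = card {p \<in> ?V. less p q}" for q
  have mono: "pos p < pos q" if V: "p \<in> ?V" "q \<in> ?V" and pq: "less p q" for p q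
  proof -
    have "{u \<in> ?V. less u p} \<subseteq> {u \<in> ?V. less u q}"
      using trans V pq by blast
    moreover have "p \<in> {u \<in> ?V. less u q}" "p \<notin> {u \<in> ?V. less u p}"
      using V pq irrefl by auto
    ultimately show ?thesis
      unfolding pos_def using fin by (intro psubset_card_mono) auto
  qed
  have less_iff: "pos p < pos q \<longleftrightarrow> less p q" if "p \<in> ?V" "q \<in> ?V" for p q
    using mono that total irrefl by (metis less_asym)
  have "clockwise_polygon_edge ?V pos a b"
  proof
    show "inj_on pos ?V"
      using mono total by (intro inj_onI) (metis less_irrefl)
    show "orient p q r < 0" if V: "p \<in> ?V" "q \<in> ?V" "r \<in> ?V" and lt: "pos p < pos q" "pos q < pos r" for p q r
    proof -
      have pqr: "less p q" "less q r" "less p r"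
        using V lt less_iff less_trans by metis+
      show ?thesis
      proof (cases "r = a")
        case True
        then show ?thesis
          using pqr orient_rotate[of q a p] orient_rotate unfolding less_def by (metis less_irrefl orient_degenerate(2))
      next
        case False
        then have "orient a p q < 0" "orient a q r < 0" "orient a p r < 0" "q \<noteq> a" "q \<noteq> p" "q \<noteq> r"
          using pqr irrefl unfolding less_def by auto
        then show ?thesis
          using vertex_not_in_triangle[OF P a V] by blast
      qed
    qed
    show "pos b \<le> pos v" if "v \<in> ?V" for v
      using b_less[OF that] mono[OF b that] by (cases "v = b") auto
    show "pos v \<le> pos a" if "v \<in> ?V" for v
      using mono[OF that a] by (cases "v = a") (auto simp: less_def)
  qed (use fin a b card in auto)
  then show thesis
    by (rule that)
qed

section \<open>Labels of the maximal simplices\<close>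

context clockwise_polygon_edge
begin

lemma finite_nc_link: "finite (nc_link V)"
proof (rule finite_subset)
  show "nc_link V \<subseteq> Pow (noncrossing_partitions V)"
    by (auto simp: nc_link_def order_complex_def)
qed (simp add: finite_nc)

text \<open>A noncrossing partition strictly between two neighbours of the chain could be added to the
  simplex.\<close>

lemma maximal_chain_saturated:
  assumes F: "maximal_simplex (nc_link V) F"
  defines "ps \<equiv> full_chain V F"
  shows "set ps = insert (nc_bot V) (insert (nc_top V) F)"
    and "saturated_chain V pos ps"
proof -
  let ?NC = "noncrossing_partitions V" and ?C = "insert (nc_bot V) (insert (nc_top V) F)"
  let ?less = "\<lambda>\<pi> \<pi>'. refines V \<pi> \<pi>' \<and> \<pi> \<noteq> \<pi>'"
  have V_ne: "V \<noteq> {}"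
    using ends by blast
  have F_link: "F \<in> nc_link V" and F_max: "\<And>G. G \<in> nc_link V \<Longrightarrow> \<not> F \<subset> G"
    using F by (auto simp: maximal_simplex_def)
  have F_sub: "F \<subseteq> inner_partitions" and F_fin: "finite F" and F_ne: "F \<noteq> {}"
    and F_chain: "\<And>\<pi> \<rho>. \<lbrakk>\<pi> \<in> F; \<rho> \<in> F\<rbrakk> \<Longrightarrow> refines V \<pi> \<rho> \<or> refines V \<rho> \<pi>"
    using F_link by (auto simp: nc_link_def order_complex_def inner_partitions_def)
  have C_nc: "?C \<subseteq> ?NC"
    using F_sub nc_bot_least(1) nc_top_greatest(1)[OF V_ne] by (auto simp: inner_partitions_def)
  have le_bot: "refines V (nc_bot V) \<pi>" and le_top: "refines V \<pi> (nc_top V)" if "\<pi> \<in> ?NC" for \<pi>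
    using that nc_bot_least(2) nc_top_greatest(2)[OF V_ne] by auto
  have C_chain: "\<forall>\<pi>\<in>?C. \<forall>\<rho>\<in>?C. refines V \<pi> \<rho> \<or> refines V \<rho> \<pi>"
    using F_chain le_bot le_top C_nc by (metis insertE subsetD)
  have anti: "antisymp_on S (refines V)" and trans: "transp_on S (refines V)" for S
    using refines_asym refines_trans by (auto simp: antisymp_on_def transp_on_def) blast+
  obtain qs where qs: "sorted_wrt ?less qs" "set qs = ?C"
    using sorted_wrt_exists[of ?C "refines V"] F_fin C_chain anti trans by blast
  have "ps = qs"
    unfolding ps_def full_chain_def
  proof (rule the_equality)
    show "xs = qs" if "sorted_wrt ?less xs \<and> set xs = ?C" for xs
      using sorted_wrt_unique[OF anti, of xs qs] that qs by simp
  qed (use qs in blast)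
  then have ps: "sorted_wrt ?less ps" "set ps = ?C"
    using qs by auto
  show "set ps = ?C"
    by (rule ps(2))
  have nc: "ps ! i \<in> ?NC" if "i < length ps" for i
    using nth_mem[OF that] unfolding ps(2) by (rule subsetD[OF C_nc])
  have less: "?less (ps ! i) (ps ! j)" if "i < j" "j < length ps" for i j
    using sorted_wrt_nth_less[OF ps(1) that] .
  have le: "refines V (ps ! i) (ps ! j)" if "i \<le> j" "j < length ps" for i j
    using less[of i j] that refines_refl[OF nc_partition_on[OF nc[of j]]] by (cases "i = j") auto
  have ps_ne: "ps \<noteq> []"
    using ps(2) by auto
  then have len: "0 < length ps" "length ps - 1 < length ps"
    by auto
  show "saturated_chain V pos ps"
  proof
    show "V \<noteq> {}" "ps \<noteq> []"
      using V_ne ps_ne by auto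
    show "ps ! i \<in> ?NC" if "i < length ps" for i
      using nc[OF that] .
    have "nc_bot V \<in> set ps" "nc_top V \<in> set ps"
      using ps(2) by auto
    then obtain i j where i: "i < length ps" "ps ! i = nc_bot V" and j: "j < length ps" "ps ! j = nc_top V"
      by (metis in_set_conv_nth)
    show "ps ! 0 = nc_bot V"
      by (rule refines_asym[of V]) (use le[of 0 i] i le_bot[OF nc[OF len(1)]] in auto)
    show "ps ! (length ps - 1) = nc_top V"
      by (rule refines_asym[of V]) (use le[of j "length ps - 1"] j len le_top[OF nc[OF len(2)]] in auto)
    show "\<exists>X\<in>ps ! i. \<exists>Y\<in>ps ! i. X \<noteq> Y \<and> ps ! Suc i = merge_blocks (ps ! i) X Y \<and>
        (\<exists>x0\<in>X. \<forall>u\<in>Y. pos x0 < pos u)" if i: "Suc i < length ps" for i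
    proof -
      have cover: "\<rho> = ps ! i \<or> \<rho> = ps ! Suc i"
        if \<rho>: "\<rho> \<in> ?NC" "refines V (ps ! i) \<rho>" "refines V \<rho> (ps ! Suc i)" for \<rho>
      proof (rule ccontr)
        assume ne: "\<not> ?thesis"
        have comparable: "refines V \<pi> \<rho> \<or> refines V \<rho> \<pi>" if \<pi>: "\<pi> \<in> set ps" for \<pi>
        proof -
          obtain j where j: "j < length ps" "\<pi> = ps ! j"
            using \<pi> by (metis in_set_conv_nth)
          show ?thesis
          proof (cases "j \<le> i")
            case True
            then show ?thesis
              using le[of j i] i j \<rho>(2) refines_trans by (metis Suc_lessD)
          next
            case False
            then show ?thesis
              using le[of "Suc i" j] j \<rho>(3) refines_trans by (metis Suc_leI not_le)
          qed
        qed
        have new: "\<rho> \<notin> set ps"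
        proof
          assume "\<rho> \<in> set ps"
          then obtain j where j: "j < length ps" "\<rho> = ps ! j"
            by (metis in_set_conv_nth)
          show False
          proof (cases "j \<le> i")
            case True
            then show False
              using le[of j i] i j \<rho>(2) ne refines_asym by (metis Suc_lessD)
          next
            case False
            then show False
              using le[of "Suc i" j] j \<rho>(3) ne refines_asym by (metis Suc_leI not_le)
          qed
        qed
        have F_comparable: "refines V \<pi> \<rho> \<or> refines V \<rho> \<pi>" if "\<pi> \<in> F" for \<pi>
          using comparable[of \<pi>] that unfolding ps(2) by blast
        have "insert \<rho> F \<in> nc_link V"
          unfolding nc_link_def order_complex_def
        proof (intro CollectI conjI ballI)
          show "insert \<rho> F \<subseteq> ?NC - {nc_bot V, nc_top V}"
            using F_sub \<rho>(1) new ps(2) by (auto simp: inner_partitions_def)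
          show "refines V \<pi> \<pi>' \<or> refines V \<pi>' \<pi>" if "\<pi> \<in> insert \<rho> F" "\<pi>' \<in> insert \<rho> F" for \<pi> \<pi>'
            using that F_comparable F_chain refines_refl[OF nc_partition_on[OF \<rho>(1)]] by (metis insertE)
        qed (use F_fin in auto)
        moreover have "F \<subset> insert \<rho> F"
          using new ps(2) by blast
        ultimately show False
          using F_max by blast
      qed
      have neq: "ps ! i \<noteq> ps ! Suc i" and ref: "refines V (ps ! i) (ps ! Suc i)"
        using less[of i "Suc i"] i by auto
      show ?thesis
      proof (rule cover_is_merge[OF nc[OF Suc_lessD[OF i]] nc[OF i] ref neq])
        show "\<rho> = ps ! i \<or> \<rho> = ps ! Suc i"
          if "\<rho> \<in> ?NC" "refines V (ps ! i) \<rho>" "refines V \<rho> (ps ! Suc i)" for \<rho>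
          using cover[OF that] .
      qed blast
    qed
  qed
qed

lemma maximal_simplex_label:
  assumes F: "maximal_simplex (nc_link V) F"
  shows "properly_ordered_noncrossing_tree V (simplex_label V F)"
    and "{a, b} \<notin> set (simplex_label V F) \<longleftrightarrow> (\<exists>\<pi>\<in>F. \<pi> \<in> middle)"
proof -
  note ps = maximal_chain_saturated[OF F]
  interpret saturated_chain_edge V pos "full_chain V F" a b
    using ps(2) clockwise_polygon_edge_axioms by (simp add: saturated_chain_edge_def)
  have label: "simplex_label V F = label"
    by (simp add: simplex_label_def label_eq Let_def)
  show "properly_ordered_noncrossing_tree V (simplex_label V F)"
    unfolding label by (rule properly_ordered_label)
  have "nc_bot V \<notin> middle" "nc_top V \<notin> middle"
    using middle_subset by (auto simp: inner_partitions_def)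
  then show "{a, b} \<notin> set (simplex_label V F) \<longleftrightarrow> (\<exists>\<pi>\<in>F. \<pi> \<in> middle)"
    unfolding label label_avoids_edge_iff ps(1) by blast
qed

text \<open>A chain that can be extended by an element of \<open>middle\<close> extends further to a maximal one, which contains
  that element.\<close>

lemma complex_avoiding_edge_eq:
  "closure_complex {F. maximal_simplex (nc_link V) F \<and>
       properly_ordered_noncrossing_tree V (simplex_label V F) \<and> {a, b} \<notin> set (simplex_label V F)} =
     {C \<in> nc_link V. \<exists>m\<in>middle. insert m C \<in> nc_link V}" (is "?K = ?L")
proof -
  have faces: "G \<in> nc_link V" if "F \<in> nc_link V" "G \<subseteq> F" "G \<noteq> {}" for F G
    using that finite_subset unfolding nc_link_def order_complex_def by (auto; blast)
  have K: "G \<in> ?K \<longleftrightarrow> G \<noteq> {} \<and> (\<exists>F. G \<subseteq> F \<and> maximal_simplex (nc_link V) F \<and> (\<exists>m\<in>F. m \<in> middle))" for G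
    unfolding closure_complex_def using maximal_simplex_label by blast
  show ?thesis
  proof (intro subset_antisym subsetI)
    fix G assume "G \<in> ?K"
    then obtain F m where "G \<noteq> {}" "G \<subseteq> F" "F \<in> nc_link V" "m \<in> F" "m \<in> middle"
      unfolding K by (auto simp: maximal_simplex_def)
    then show "G \<in> ?L"
      using faces[of F G] faces[of F "insert m G"] by blast
  next
    fix C assume "C \<in> ?L"
    then obtain m where m: "C \<in> nc_link V" "m \<in> middle" "insert m C \<in> nc_link V"
      by blast
    obtain F where "F \<in> nc_link V" "insert m C \<subseteq> F" "\<forall>G\<in>nc_link V. F \<subseteq> G \<longrightarrow> F = G"
      using finite_has_maximal2[OF finite_nc_link m(3)] by blast
    moreover have "C \<noteq> {}"
      using m(1) by (simp add: nc_link_def order_complex_def)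
    ultimately show "C \<in> ?K"
      using m(2) unfolding K by (auto simp: maximal_simplex_def)
  qed
qed

end

theorem theorem1:
  fixes n :: nat and P :: "complex set" and e :: "complex set"
  assumes "n \<ge> 3" and "convex_polygon n P" and "boundary_edge P e"
  defines "V \<equiv> vertices P"
  defines "K \<equiv> closure_complex
             {F. maximal_simplex (nc_link V) F \<and>
                 properly_ordered_noncrossing_tree V (simplex_label V F) \<and>
                 e \<notin> set (simplex_label V F)}"
  shows "subcomplex K (nc_link V) \<and> contractible_complex K"
proof -
  have P: "polytope P" "aff_dim P = 2" and card: "card V = n"
    using assms(2) by (auto simp: convex_polygon_def V_def)
  have fin: "finite V"
    using card assms(1) card.infinite by fastforce
  obtain a b where e: "e = {a, b}" and ab: "a \<in> vertices P" "b \<in> vertices P" "a \<noteq> b"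
    "\<And>u. \<lbrakk>u \<in> vertices P; u \<noteq> a; u \<noteq> b\<rbrakk> \<Longrightarrow> orient a b u < 0"
    using boundary_edge_side[OF P assms(3)] by metis
  obtain pos where "clockwise_polygon_edge V pos a b"
    using clockwise_listing[OF polytope_imp_convex[OF P(1)] _ _ ab] fin card assms(1)
    unfolding V_def by metis
  then interpret clockwise_polygon_edge V pos a b .
  have K: "K = {C \<in> nc_link V. \<exists>m\<in>middle. insert m C \<in> nc_link V}"
    unfolding K_def e by (rule complex_avoiding_edge_eq)
  have "simplicial_complex_on K"
    unfolding simplicial_complex_on_def
  proof (intro conjI ballI allI impI)
    show "finite F" "F \<noteq> {}" if "F \<in> K" for F
      using that unfolding K by (auto simp: nc_link_def order_complex_def)
    show "G \<in> K" if "F \<in> K" "G \<subseteq> F \<and> G \<noteq> {}" for F G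
      using that unfolding K_def closure_complex_def by blast
  qed
  then have "subcomplex K (nc_link V)"
    unfolding subcomplex_def K by blast
  moreover have "contractible_complex K"
    unfolding K by (rule contractible_chains_meeting_middle)
  ultimately show ?thesis ..
qed

end
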